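(* Let $\{\xi_i\}_{i\ge1}$ be a non-decreasing sequence of positive reals, let $N\ge 1$ and let $g\in\mathcal G(N,\xi)$. Then the transition matrices $P_N(\,\cdot\,;g)$, $P_{N-1}(\,\cdot\,;g)$ commute with the link $P_N^{\downarrow}$, i.e. for all $\lambda\in\mathbb{GT}_N$ and $\kappa\in\mathbb{GT}_{N-1}$ $$\sum_{\mu\in\mathbb{GT}_N}P_N(\lambda\to\mu;g)\,P_N^{\downarrow}(\mu\to\kappa)=\sum_{\theta\in\mathbb{GT}_{N-1}}P_N^{\downarrow}(\lambda\to\theta)\,P_{N-1}(\theta\to\kappa;g).$$
   Context: $\mathbb{GT}_N=\{\lambda=(\lambda_1\ge\dots\ge\lambda_N):\lambda_i\in\mathbb Z\}$ (signatures of length $N$), $\mathbb{GT}_0=\{\varnothing\}$, $|\lambda|=\sum_i\lambda_i$. The rational Schur function is the Laurent polynomial $s_\lambda(x_1,\dots,x_N)=\det[x_i^{\lambda_j+N-j}]_{i,j=1}^N/\prod_{i<j}(x_i-x_j)$. $\mathcal G(N,\xi)$ is the set of all finite products of functions of the following types: $x$; $x^{-1}$; $1+\beta x$, $1+\beta x^{-1}$ with $\beta>0$; $e^{\gamma x}$, $e^{\gamma x^{-1}}$ with $\gamma>0$; $(1-\alpha x)^{-1}$ with $0<\alpha<\xi_N^{-1}$; $(1-\alpha x^{-1})^{-1}$ with $0<\alpha<\xi_1$. (So $\mathcal G(N,\xi)\subset\mathcal G(N-1,\xi)$.) For $g\in\mathcal G(N,\xi)$ with Laurent expansion $g(x)=\sum_{k\in\mathbb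 Z}c_kx^k$ converging for $\xi_1\le|x|\le\xi_N$, the stochastic matrix $P_N(\,\cdot\,;g)$ on $\mathbb{GT}_N$ is $$P_N(\lambda\to\mu;g)=\Big(\prod_{i=1}^N\frac1{g(\xi_i)}\Big)\det_{i,j=1,\dots,N}\big[c_{\mu_i-i-\lambda_j+j}\big]\frac{s_\mu(\xi_1,\dots,\xi_N)}{s_\lambda(\xi_1,\dots,\xi_N)},$$ and $P_0$ is the $1\times1$ identity matrix. For $\mu\in\mathbb{GT}_{N-1}$, $\lambda\in\mathbb{GT}_N$, $\mu\prec\lambda$ means $\lambda_1\ge\mu_1\ge\lambda_2\ge\dots\ge\mu_{N-1}\ge\lambda_N$. The link $P_N^\downarrow$ is the stochastic matrix from $\mathbb{GT}_N$ to $\mathbb{GT}_{N-1}$ with $$P_N^\downarrow(\lambda\to\mu)=\xi_N^{|\lambda|-|\mu|}\frac{s_\mu(\xi_1,\dots,\xi_{N-1})}{s_\lambda(\xi_1,\dots,\xi_N)}\ \text{ if }\mu\prec\lambda,\qquad 0\text{ otherwise.}$$ *)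

theory Defs
  imports
    "HOL-Analysis.Infinite_Sum"
    "HOL-Library.Poly_Mapping"
    "Jordan_Normal_Form.Determinant"
begin

text \<open>
  A signature \<open>\<lambda>\<^sub>1 \<ge> \<dots> \<ge> \<lambda>\<^sub>N\<close> is a list, so \<open>\<lambda>\<^sub>i\<close> is \<open>la ! (i - 1)\<close>. Sequences \<open>\<xi>\<close> and
  the variables \<open>x\<^sub>1, x\<^sub>2, \<dots>\<close> keep their indices starting from 1; \<open>\<xi> 0\<close> is never used when \<open>N \<ge> 1\<close>.
\<close>

definition signatures :: "nat \<Rightarrow> int list set" where
  "signatures N = {la. length la = N \<and> sorted_wrt (\<ge>) la}"

text \<open>
  Real Laurent polynomials in \<open>x\<^sub>0, x\<^sub>1, \<dots>\<close>: finitely supported functions on the group of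
  finitely supported integer exponent vectors, with convolution as product.
  They form an integral domain.
\<close>

type_synonym laurent_poly = "(nat \<Rightarrow>\<^sub>0 int) \<Rightarrow>\<^sub>0 real"

definition lvar_powi :: "nat \<Rightarrow> int \<Rightarrow> laurent_poly" where
  "lvar_powi i k = Poly_Mapping.single (Poly_Mapping.single i k) 1"

definition laurent_eval :: "(nat \<Rightarrow> real) \<Rightarrow> laurent_poly \<Rightarrow> real" where
  "laurent_eval x p =
     (\<Sum>m\<in>Poly_Mapping.keys p. Poly_Mapping.lookup p m *
        (\<Prod>i\<in>Poly_Mapping.keys m. x i powi Poly_Mapping.lookup m i))"

text \<open>
  The quotient of the alternant by the Vandermonde product is taken in the ring of Laurent
  polynomials, where it exists and is unique. It is evaluated only afterwards, because the
  \<open>\<xi>\<^sub>i\<close> need not be distinct.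
  Matrix indices start from 0, hence \<open>x\<^sub>i\<^sub>+\<^sub>1\<close> and the exponent \<open>\<lambda>\<^sub>j\<^sub>+\<^sub>1 + N - (j + 1)\<close>.
\<close>

definition rational_schur :: "nat \<Rightarrow> int list \<Rightarrow> laurent_poly" where
  "rational_schur N la =
     (THE s. s * (\<Prod>(i, j)\<in>{(i, j). 1 \<le> i \<and> i < j \<and> j \<le> N}. lvar_powi i 1 - lvar_powi j 1) =
        det (mat N N (\<lambda>(i, j). lvar_powi (Suc i) (la ! j + int N - int (Suc j)))))"

definition schur_value :: "(nat \<Rightarrow> real) \<Rightarrow> nat \<Rightarrow> int list \<Rightarrow> real" where
  "schur_value \<xi> N la = laurent_eval \<xi> (rational_schur N la)"

definition elementary_fun :: "nat \<Rightarrow> (nat \<Rightarrow> real) \<Rightarrow> (complex \<Rightarrow> complex) set" where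
  "elementary_fun N \<xi> =
     {\<lambda>x. x, \<lambda>x. inverse x}
     \<union> {\<lambda>x. 1 + of_real \<beta> * x | \<beta>. \<beta> > 0}
     \<union> {\<lambda>x. 1 + of_real \<beta> * inverse x | \<beta>. \<beta> > 0}
     \<union> {\<lambda>x. exp (of_real \<gamma> * x) | \<gamma>. \<gamma> > 0}
     \<union> {\<lambda>x. exp (of_real \<gamma> * inverse x) | \<gamma>. \<gamma> > 0}
     \<union> {\<lambda>x. inverse (1 - of_real \<alpha> * x) | \<alpha>. 0 < \<alpha> \<and> \<alpha> < inverse (\<xi> N)}
     \<union> {\<lambda>x. inverse (1 - of_real \<alpha> * inverse x) | \<alpha>. 0 < \<alpha> \<and> \<alpha> < \<xi> 1}"

definition admissible_fun :: "nat \<Rightarrow> (nat \<Rightarrow> real) \<Rightarrow> (complex \<Rightarrow> complex) set" where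
  "admissible_fun N \<xi> =
     {\<lambda>x. \<Prod>f\<leftarrow>fs. f x | fs. set fs \<subseteq> elementary_fun N \<xi>}"

text \<open>
  The bilateral Laurent coefficients on the closed annulus. For functions in
  \<open>admissible_fun N \<xi>\<close> they are real and the series converges absolutely there.
\<close>

definition laurent_coeff ::
    "(nat \<Rightarrow> real) \<Rightarrow> nat \<Rightarrow> (complex \<Rightarrow> complex) \<Rightarrow> int \<Rightarrow> real" where
  "laurent_coeff \<xi> N g =
     (THE c. \<forall>x. \<xi> 1 \<le> norm x \<and> norm x \<le> \<xi> N \<longrightarrow>
        ((\<lambda>k. of_real (c k) * x powi k) has_sum g x) UNIV)"

text \<open>
  Functions in \<open>admissible_fun N \<xi>\<close> are real and positive at \<open>\<xi> 1, \<dots>, \<xi> N\<close>, so \<open>Re\<close> is only a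
  coercion. With row and column indices starting from 0 the shift \<open>- i + j\<close> is unchanged.
\<close>

definition transition ::
    "(nat \<Rightarrow> real) \<Rightarrow> nat \<Rightarrow> (complex \<Rightarrow> complex) \<Rightarrow> int list \<Rightarrow> int list \<Rightarrow> real" where
  "transition \<xi> N g la mu =
     (if N = 0 then (if la = mu then 1 else 0)
      else (\<Prod>i=1..N. 1 / Re (g (of_real (\<xi> i))))
           * det (mat N N (\<lambda>(i, j). laurent_coeff \<xi> N g (mu ! i - int i - la ! j + int j)))
           * (schur_value \<xi> N mu / schur_value \<xi> N la))"

definition interlaces :: "int list \<Rightarrow> int list \<Rightarrow> bool" where
  "interlaces mu la \<longleftrightarrow> length la = Suc (length mu) \<and>
     (\<forall>i<length mu. la ! i \<ge> mu ! i \<and> mu ! i \<ge> la ! Suc i)"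

definition link :: "(nat \<Rightarrow> real) \<Rightarrow> nat \<Rightarrow> int list \<Rightarrow> int list \<Rightarrow> real" where
  "link \<xi> N la mu =
     (if interlaces mu la
      then \<xi> N powi (sum_list la - sum_list mu)
           * (schur_value \<xi> (N - 1) mu / schur_value \<xi> N la)
      else 0)"

end

theory Submission
  imports Defs "HOL-Analysis.Elementary_Metric_Spaces"
begin

text \<open>
  After cancelling Schur values and powers of \<open>y = \<xi>\<^sub>N\<close>, both sides are sums over interlacing
  signatures of determinants with entries \<open>e k = c\<^sub>k y\<^sup>k\<close>. Interlacing confines each shifted entry of the
  summation variable to an interval, independently of the others, so by multilinearity the sums
  move inside the determinants. With \<open>k\<^sub>i = \<kappa>\<^sub>i - i\<close>, \<open>l\<^sub>j = \<lambda>\<^sub>j - j\<close> and the tail sums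
  \<open>G m = (\<Sum>k\<ge>m. e k)\<close>, row operations turn the left side into the determinant of a matrix with rows \<open>G (k\<^sub>i - l\<^sub>j)\<close> and a last row constantly \<open>g y\<close>;
  column differences then reduce it to \<open>g y\<close> times the determinant of
  \<open>G (k\<^sub>i - l\<^sub>j) - G (k\<^sub>i - l\<^sub>j\<^sub>+\<^sub>1)\<close>, which is the right side.
  Cancelling requires that Schur values do not vanish: the same column operations
  give the branching rule, hence a representation with nonnegative coefficients.
\<close>

subsection \<open>Determinants and interlacing\<close>

text \<open>Each Leibniz term takes exactly one entry from every row and every column, so it
  contains every \<open>r i\<close> and every \<open>s j\<close> once.\<close>

lemma det_rows_cols_scaled:
  fixes a :: "nat \<Rightarrow> nat \<Rightarrow> 'a::comm_ring_1"
  shows "det (mat n n (\<lambda>(i, j). r i * s j * a i j)) =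
    (\<Prod>i<n. r i) * (\<Prod>j<n. s j) * det (mat n n (\<lambda>(i, j). a i j))"
proof -
  have "(\<Prod>i = 0..<n. mat n n (\<lambda>(i, j). r i * s j * a i j) $$ (i, p i)) =
    (\<Prod>i<n. r i) * (\<Prod>j<n. s j) * (\<Prod>i = 0..<n. mat n n (\<lambda>(i, j). a i j) $$ (i, p i))"
    if p: "p permutes {0..<n}" for p
  proof -
    have lt: "p i < n" if "i < n" for i
      using permutes_in_image[OF p, of i] that by simp
    have "(\<Prod>i = 0..<n. mat n n (\<lambda>(i, j). r i * s j * a i j) $$ (i, p i)) =
        (\<Prod>i = 0..<n. r i * s (p i) * a i (p i))"
      by (intro prod.cong) (auto simp: lt)
    moreover have "(\<Prod>i = 0..<n. mat n n (\<lambda>(i, j). a i j) $$ (i, p i)) = (\<Prod>i = 0..<n. a i (p i))"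
      by (intro prod.cong) (auto simp: lt)
    moreover have "(\<Prod>i = 0..<n. s (p i)) = (\<Prod>j<n. s j)"
      using prod.permute[OF p, of s] by (simp add: o_def atLeast0LessThan)
    ultimately show ?thesis
      by (simp add: prod.distrib atLeast0LessThan)
  qed
  then show ?thesis
    by (subst (1 2) det_def'[of _ n]) (auto simp: sum_distrib_left mult_ac intro!: sum.cong)
qed

text \<open>Multiplying by this unimodular matrix on the right subtracts from each column its
  successor; on the left, from each row its predecessor.\<close>

definition difference_mat :: "nat \<Rightarrow> 'a::comm_ring_1 mat" where
  "difference_mat n = mat n n (\<lambda>(k, j). if k = j then 1 else if k = Suc j then - 1 else 0)"

lemma det_difference_mat: "det (difference_mat n :: 'a::comm_ring_1 mat) = 1"
proof -
  have "det (difference_mat n :: 'a mat) = prod_list (diag_mat (difference_mat n :: 'a mat))"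
    by (rule det_lower_triangular[of n]) (auto simp: difference_mat_def)
  also have "diag_mat (difference_mat n :: 'a mat) = map (\<lambda>_. 1) [0..<n]"
    by (auto simp: diag_mat_def difference_mat_def)
  also have "prod_list (map (\<lambda>_. 1 :: 'a) [0..<n]) = 1"
    by (induction n) auto
  finally show ?thesis .
qed

lemma det_consecutive_col_differences:
  fixes a :: "nat \<Rightarrow> nat \<Rightarrow> 'a::comm_ring_1"
  shows "det (mat n n (\<lambda>(i, j). if Suc j < n then a i j - a i (Suc j) else a i j)) =
    det (mat n n (\<lambda>(i, j). a i j))"
proof -
  have "mat n n (\<lambda>(i, j). if Suc j < n then a i j - a i (Suc j) else a i j) =
      mat n n (\<lambda>(i, j). a i j) * difference_mat n" (is "?L = ?R")
  proof (rule eq_matI)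
    fix i j assume "i < dim_row ?R" "j < dim_col ?R"
    then have i: "i < n" and j: "j < n"
      by (auto simp: difference_mat_def)
    have "?R $$ (i, j) = (\<Sum>k = 0..<n. (if k = j then a i k else 0) - (if k = Suc j then a i k else 0))"
      using i j by (auto simp: difference_mat_def scalar_prod_def intro!: sum.cong)
    also have "\<dots> = ?L $$ (i, j)"
      using i j by (simp add: sum_subtractf)
    finally show "?L $$ (i, j) = ?R $$ (i, j)" ..
  qed (auto simp: difference_mat_def)
  then show ?thesis
    using det_mult[of "mat n n (\<lambda>(i, j). a i j)" n "difference_mat n"]
    by (simp add: det_difference_mat) (simp add: difference_mat_def)
qed

lemma det_consecutive_row_differences:
  fixes a :: "nat \<Rightarrow> nat \<Rightarrow> 'a::comm_ring_1"
  shows "det (mat n n (\<lambda>(i, j). if 0 < i then a i j - a (i - 1) j else a i j)) =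
    det (mat n n (\<lambda>(i, j). a i j))"
proof -
  have "mat n n (\<lambda>(i, j). if 0 < i then a i j - a (i - 1) j else a i j) =
      difference_mat n * mat n n (\<lambda>(i, j). a i j)" (is "?L = ?R")
  proof (rule eq_matI)
    fix i j assume "i < dim_row ?R" "j < dim_col ?R"
    then have i: "i < n" and j: "j < n"
      by (auto simp: difference_mat_def)
    have "?R $$ (i, j) =
        (\<Sum>k = 0..<n. (if k = i then a k j else 0) - (if 0 < i \<and> k = i - 1 then a k j else 0))"
      using i j by (auto simp: difference_mat_def scalar_prod_def intro!: sum.cong)
    also have "\<dots> = ?L $$ (i, j)"
      using i j by (cases i) (simp_all add: sum_subtractf)
    finally show "?L $$ (i, j) = ?R $$ (i, j)" ..
  qed (auto simp: difference_mat_def)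
  then show ?thesis
    using det_mult[of "difference_mat n" n "mat n n (\<lambda>(i, j). a i j)"]
    by (simp add: det_difference_mat) (simp add: difference_mat_def)
qed

text \<open>Consecutive column differences turn the last row into zeros followed by
  \<open>v\<close>, so expansion along that row leaves a single cofactor.\<close>

lemma det_last_row_constant:
  fixes a :: "nat \<Rightarrow> nat \<Rightarrow> 'a::comm_ring_1"
  assumes const: "\<And>j. j \<le> n \<Longrightarrow> a n j = v"
  shows "det (mat (Suc n) (Suc n) (\<lambda>(i, j). a i j)) =
    v * det (mat n n (\<lambda>(i, j). a i j - a i (Suc j)))"
proof -
  define M where
    "M = mat (Suc n) (Suc n) (\<lambda>(i, j). if Suc j < Suc n then a i j - a i (Suc j) else a i j)"
  have M: "M \<in> carrier_mat (Suc n) (Suc n)"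
    by (simp add: M_def)
  have "det (mat (Suc n) (Suc n) (\<lambda>(i, j). a i j)) = det M"
    unfolding M_def by (rule det_consecutive_col_differences[symmetric])
  also have "det M = (\<Sum>j<Suc n. M $$ (n, j) * cofactor M n j)"
    by (rule laplace_expansion_row[OF M]) simp
  also have "\<dots> = M $$ (n, n) * cofactor M n n"
    using const by (auto simp: M_def intro!: sum.neutral)
  also have "mat_delete M n n = mat n n (\<lambda>(i, j). a i j - a i (Suc j))"
    by (rule eq_matI) (auto simp: mat_delete_def M_def)
  \<comment> \<open>The cofactor sign has exponent \<open>n + n\<close>; rewriting it as
    \<open>2 * n\<close> shows that it is even.\<close>
  then have "M $$ (n, n) * cofactor M n n = v * det (mat n n (\<lambda>(i, j). a i j - a i (Suc j)))"
    using const by (simp add: cofactor_def M_def flip: mult_2)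
  finally show ?thesis .
qed

section \<open>Moving sums into determinants\<close>

text \<open>Multilinearity in the columns: since \<open>T j\<close> depends on the column alone, a
  single choice \<open>f j\<close> serves all rows. The Leibniz formula is therefore written with
  its product over columns.\<close>

lemma det_sum_cols:
  fixes h :: "nat \<Rightarrow> nat \<Rightarrow> 'b \<Rightarrow> 'a::comm_ring_1"
  assumes fin: "\<And>j. j < n \<Longrightarrow> finite (T j)"
  shows "det (mat n n (\<lambda>(i, j). \<Sum>t\<in>T j. h i j t)) =
    (\<Sum>f\<in>PiE {..<n} T. det (mat n n (\<lambda>(i, j). h i j (f j))))"
proof -
  have det: "det (mat n n (\<lambda>(i, j). b i j)) =
      (\<Sum>p | p permutes {0..<n}. signof p * (\<Prod>j<n. b (p j) j))" for b :: "nat \<Rightarrow> nat \<Rightarrow> 'a"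
    by (subst mat_det_left_def[of _ n])
       (auto intro!: sum.cong prod.cong simp: permutes_in_image[of _ "{0..<n}", simplified] simp flip: atLeast0LessThan)
  have "(\<Prod>j<n. \<Sum>t\<in>T j. h (p j) j t) = (\<Sum>f\<in>PiE {..<n} T. \<Prod>j<n. h (p j) j (f j))" for p
    using prod_sum_PiE[of "{..<n}" T "\<lambda>j. h (p j) j"] fin by simp
  then have "det (mat n n (\<lambda>(i, j). \<Sum>t\<in>T j. h i j t)) =
      (\<Sum>p | p permutes {0..<n}. \<Sum>f\<in>PiE {..<n} T. signof p * (\<Prod>j<n. h (p j) j (f j)))"
    by (simp add: det sum_distrib_left)
  then show ?thesis
    by (simp add: det sum.swap[of _ "PiE {..<n} T"])
qed

text \<open>Absolute summability of both factors gives summability over the product set, and the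
  iterated sum then identifies the value.\<close>

lemma has_sum_times:
  fixes f :: "'a \<Rightarrow> 'c::{banach, real_normed_field}"
  assumes "f abs_summable_on A" "g abs_summable_on B" "(f has_sum a) A" "(g has_sum b) B"
  shows "((\<lambda>(x, y). f x * g y) has_sum a * b) (A \<times> B)"
proof (rule has_sum_SigmaI[where g = "\<lambda>x. f x * b"])
  show "((\<lambda>y. case (x, y) of (x, y) \<Rightarrow> f x * g y) has_sum f x * b) B" for x
    using has_sum_cmult_right[OF assms(4), of "f x"] by simp
  show "((\<lambda>x. f x * b) has_sum a * b) A"
    using assms(3) by (rule has_sum_cmult_left)
  have "(\<lambda>(x, y). f x * g y) abs_summable_on A \<times> B"
    unfolding abs_summable_on_Sigma_iff using assms(1,2)
    by (auto simp: norm_mult abs_mult infsum_cmult_right' infsum_nonneg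
        intro!: summable_on_cmult_right summable_on_cmult_left)
  then show "(\<lambda>(x, y). f x * g y) summable_on A \<times> B"
    by (rule abs_summable_summable)
qed

lemma has_sum_imp_abs_summable_real:
  fixes f :: "'a \<Rightarrow> real"
  shows "(f has_sum s) A \<Longrightarrow> f abs_summable_on A"
  using has_sum_imp_summable summable_on_iff_abs_summable_on_real by blast

text \<open>Distributivity for infinite sums. Induction on \<open>A\<close> splits off one
  coordinate; over the reals every \<open>has_sum\<close> is absolute, so
  \<open>has_sum_times\<close> applies.\<close>

lemma has_sum_prod_PiE:
  fixes f :: "'a \<Rightarrow> 'b \<Rightarrow> real"
  assumes "finite A" "\<And>x. x \<in> A \<Longrightarrow> (f x has_sum s x) (B x)"
  shows "((\<lambda>g. \<Prod>x\<in>A. f x (g x)) has_sum (\<Prod>x\<in>A. s x)) (PiE A B)"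
  using assms
proof (induction A rule: finite_induct)
  case empty
  then show ?case by (simp add: has_sum_finiteI)
next
  case (insert x F)
  have F: "((\<lambda>g. \<Prod>x\<in>F. f x (g x)) has_sum (\<Prod>x\<in>F. s x)) (PiE F B)"
    and x: "(f x has_sum s x) (B x)"
    using insert by auto
  have "((\<lambda>(y, g). f x y * (\<Prod>x\<in>F. f x (g x))) has_sum s x * (\<Prod>x\<in>F. s x)) (B x \<times> PiE F B)"
    using x F by (intro has_sum_times has_sum_imp_abs_summable_real)
  moreover have "(\<Prod>z\<in>F. f z (if z = x then y else g z)) = (\<Prod>z\<in>F. f z (g z))" for g y
    using insert.hyps by (intro prod.cong) auto
  ultimately show ?case
    unfolding PiE_insert_eq using insert.hyps
    by (subst has_sum_reindex[OF inj_combinator]) (auto simp: o_def case_prod_unfold)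
qed

lemma has_sum_finite_sum:
  fixes f :: "'i \<Rightarrow> 'b \<Rightarrow> 'c::topological_comm_monoid_add"
  assumes "finite I" "\<And>i. i \<in> I \<Longrightarrow> (f i has_sum s i) A"
  shows "((\<lambda>x. \<Sum>i\<in>I. f i x) has_sum (\<Sum>i\<in>I. s i)) A"
  using assms by (induction I rule: finite_induct) (auto intro: has_sum_add)

text \<open>Infinite counterpart of \<open>det_sum_cols\<close>, by rows: each of the finitely many
  Leibniz terms is a product of one-variable series.\<close>

lemma has_sum_det_rows:
  fixes h :: "nat \<Rightarrow> nat \<Rightarrow> 'b \<Rightarrow> real"
  assumes "\<And>i j. i < n \<Longrightarrow> j < n \<Longrightarrow> (h i j has_sum s i j) (T i)"
  shows "((\<lambda>f. det (mat n n (\<lambda>(i, j). h i j (f i)))) has_sum det (mat n n (\<lambda>(i, j). s i j)))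
    (PiE {..<n} T)"
proof -
  have det: "det (mat n n (\<lambda>(i, j). b i j)) =
      (\<Sum>p | p permutes {0..<n}. signof p * (\<Prod>i<n. b i (p i)))" for b :: "nat \<Rightarrow> nat \<Rightarrow> real"
    by (subst det_def'[of _ n])
       (auto intro!: sum.cong prod.cong simp: permutes_in_image[of _ "{0..<n}", simplified] simp flip: atLeast0LessThan)
  have "((\<lambda>f. signof p * (\<Prod>i<n. h i (p i) (f i))) has_sum signof p * (\<Prod>i<n. s i (p i)))
      (PiE {..<n} T)" if p: "p permutes {0..<n}" for p
    using permutes_in_image[OF p] by (intro has_sum_cmult_right has_sum_prod_PiE assms) auto
  then show ?thesis
    unfolding det by (intro has_sum_finite_sum) (auto simp: finite_permutations)
qed

section \<open>Interlacing lists as products of intervals\<close>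

text \<open>Translates sums over lists into sums over choice functions; \<open>restrict\<close>
  supplies the value \<open>undefined\<close> that \<open>PiE\<close> demands outside the index
  set.\<close>

lemma bij_betw_list_PiE:
  "bij_betw (\<lambda>xs. restrict ((!) xs) {..<n}) {xs. length xs = n \<and> (\<forall>i<n. xs ! i \<in> T i)} (PiE {..<n} T)"
proof (rule bij_betwI[where g = "\<lambda>f. map f [0..<n]"])
  fix xs assume "xs \<in> {xs. length xs = n \<and> (\<forall>i<n. xs ! i \<in> T i)}"
  then show "map (restrict ((!) xs) {..<n}) [0..<n] = xs"
    by (intro nth_equalityI) simp_all
next
  fix f assume f: "f \<in> PiE {..<n} T"
  show "restrict ((!) (map f [0..<n])) {..<n} = f"
    by (rule ext) (use PiE_arb[OF f] in \<open>simp add: restrict_def\<close>)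
qed (simp_all add: Pi_iff PiE_iff)

lemma interlaces_below_eq:
  assumes "length la = Suc n"
  shows "{mu. interlaces mu la} = {mu. length mu = n \<and> (\<forall>j<n. mu ! j \<in> {la ! Suc j..la ! j})}"
  using assms by (auto simp: interlaces_def)

lemma finite_interlaces_below: "finite {mu. interlaces mu la}"
proof (cases la)
  case Nil
  then show ?thesis by (simp add: interlaces_def)
next
  case (Cons a la')
  have "finite {mu. length mu = length la' \<and> (\<forall>j<length la'. mu ! j \<in> {la ! Suc j..la ! j})}"
    using bij_betw_finite[OF bij_betw_list_PiE[of "length la'" "\<lambda>j. {la ! Suc j..la ! j}"]]
    by (simp add: finite_PiE)
  then show ?thesis
    by (subst interlaces_below_eq[of la "length la'"]) (simp_all add: Cons)
qed

text \<open>Interlacing bounds each \<open>mu ! j\<close> independently, so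
  \<open>det_sum_cols\<close> applies; the substitution \<open>t = mu ! j - int j\<close> then
  shifts both ends of the interval by \<open>j\<close>.\<close>

lemma sum_det_interlaces_below:
  fixes h :: "nat \<Rightarrow> int \<Rightarrow> 'a::comm_ring_1"
  assumes la: "length la = Suc n"
  shows "(\<Sum>mu | interlaces mu la. det (mat n n (\<lambda>(i, j). h i (mu ! j - int j)))) =
    det (mat n n (\<lambda>(i, j). \<Sum>t = la ! Suc j - int j..la ! j - int j. h i t))"
proof -
  have "(\<Sum>mu | interlaces mu la. det (mat n n (\<lambda>(i, j). h i (mu ! j - int j)))) =
      (\<Sum>f\<in>PiE {..<n} (\<lambda>j. {la ! Suc j..la ! j}). det (mat n n (\<lambda>(i, j). h i (f j - int j))))"
    unfolding interlaces_below_eq[OF la]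
    by (subst sum.reindex_bij_betw[OF bij_betw_list_PiE, symmetric])
       (auto intro!: sum.cong arg_cong[where f = det] cong_mat)
  also have "\<dots> = det (mat n n (\<lambda>(i, j). \<Sum>m = la ! Suc j..la ! j. h i (m - int j)))"
    by (rule det_sum_cols[symmetric]) auto
  also have "\<dots> = det (mat n n (\<lambda>(i, j). \<Sum>t = la ! Suc j - int j..la ! j - int j. h i t))"
  proof -
    have "(\<Sum>m = la ! Suc j..la ! j. h i (m - int j)) =
        (\<Sum>t = la ! Suc j - int j..la ! j - int j. h i t)" for i j
      by (rule sum.reindex_bij_witness[of _ "\<lambda>t. t + int j" "\<lambda>m. m - int j"]) auto
    then show ?thesis by simp
  qed
  finally show ?thesis .
qed

text \<open>The guards encode that the first entry has no upper bound and the last one no lower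
  bound, so these sums are infinite.\<close>

lemma interlaces_above_eq:
  assumes "length kap = n"
  shows "{mu. interlaces kap mu} = {mu. length mu = Suc n \<and> (\<forall>i<Suc n. mu ! i \<in>
    {m. (i < n \<longrightarrow> kap ! i \<le> m) \<and> (0 < i \<longrightarrow> m \<le> kap ! (i - 1))})}"
proof (intro Collect_cong iffI)
  fix mu assume "interlaces kap mu"
  then show "length mu = Suc n \<and> (\<forall>i<Suc n. mu ! i \<in>
      {m. (i < n \<longrightarrow> kap ! i \<le> m) \<and> (0 < i \<longrightarrow> m \<le> kap ! (i - 1))})"
    using assms by (auto simp: interlaces_def gr0_conv_Suc)
next
  fix mu assume mu: "length mu = Suc n \<and> (\<forall>i<Suc n. mu ! i \<in>
      {m. (i < n \<longrightarrow> kap ! i \<le> m) \<and> (0 < i \<longrightarrow> m \<le> kap ! (i - 1))})"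
  then have "kap ! i \<le> mu ! i" "mu ! Suc i \<le> kap ! i" if "i < n" for i
    using that mu[THEN conjunct2, rule_format, of "Suc i"] by auto
  then show "interlaces kap mu"
    using mu assms by (auto simp: interlaces_def)
qed

text \<open>For \<open>t = m - int i\<close> the bound \<open>m \<le> kap ! (i - 1)\<close> becomes
  strict, \<open>t < kap ! (i - 1) - int (i - 1)\<close>: the ranges of successive rows are adjacent
  and disjoint, which makes tail sums telescope.\<close>

lemma has_sum_det_interlaces_above:
  fixes h :: "nat \<Rightarrow> int \<Rightarrow> real"
  assumes kap: "length kap = n"
    and h: "\<And>i j. i \<le> n \<Longrightarrow> j \<le> n \<Longrightarrow> (h j has_sum s i j)
      {t. (i < n \<longrightarrow> kap ! i - int i \<le> t) \<and> (0 < i \<longrightarrow> t < kap ! (i - 1) - int (i - 1))}"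
  shows "((\<lambda>mu. det (mat (Suc n) (Suc n) (\<lambda>(i, j). h j (mu ! i - int i)))) has_sum
    det (mat (Suc n) (Suc n) (\<lambda>(i, j). s i j))) {mu. interlaces kap mu}"
proof -
  define T where "T = (\<lambda>i. {m. (i < n \<longrightarrow> kap ! i \<le> m) \<and> (0 < i \<longrightarrow> m \<le> kap ! (i - 1))})"
  have "((\<lambda>m. h j (m - int i)) has_sum s i j) (T i)" if "i \<le> n" "j \<le> n" for i j
    using h[OF that] unfolding T_def
    by (subst has_sum_reindex_bij_witness[of _ "\<lambda>t. t + int i" "\<lambda>m. m - int i"]) auto
  then have "((\<lambda>f. det (mat (Suc n) (Suc n) (\<lambda>(i, j). h j (f i - int i)))) has_sum
      det (mat (Suc n) (Suc n) (\<lambda>(i, j). s i j))) (PiE {..<Suc n} T)"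
    by (intro has_sum_det_rows[where h = "\<lambda>i j m. h j (m - int i)"]) auto
  then have "((\<lambda>mu. det (mat (Suc n) (Suc n) (\<lambda>(i, j). h j (restrict ((!) mu) {..<Suc n} i - int i))))
      has_sum det (mat (Suc n) (Suc n) (\<lambda>(i, j). s i j)))
      {mu. length mu = Suc n \<and> (\<forall>i<Suc n. mu ! i \<in> T i)}"
    by (subst has_sum_reindex_bij_betw[OF bij_betw_list_PiE])
  then show ?thesis
    unfolding interlaces_above_eq[OF kap] T_def
    by (rule has_sum_cong[THEN iffD1, rotated]) (auto intro!: arg_cong[where f = det] cong_mat)
qed

lemma signatures_nth_mono:
  assumes "la \<in> signatures n" "i \<le> j" "j < n"
  shows "la ! j \<le> la ! i"
  using assms by (cases "i = j") (auto simp: signatures_def sorted_wrt_iff_nth_less)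

text \<open>The commutation relation stripped of Schur values and normalising factors.\<close>

lemma has_sum_det_interlaces:
  fixes e :: "int \<Rightarrow> real"
  assumes e: "(e has_sum v) UNIV" and la: "la \<in> signatures (Suc n)" and kap: "kap \<in> signatures n"
  shows "((\<lambda>mu. det (mat (Suc n) (Suc n) (\<lambda>(i, j). e (mu ! i - int i - la ! j + int j)))) has_sum
      v * (\<Sum>th | interlaces th la. det (mat n n (\<lambda>(i, j). e (kap ! i - int i - th ! j + int j)))))
    {mu. interlaces kap mu}"
proof -
  define l where "l = (\<lambda>j. la ! j - int j)"
  define k where "k = (\<lambda>i. kap ! i - int i)"
  define G where "G = (\<lambda>m. infsum e {m..})"
  \<comment> \<open>Row \<open>n\<close> has no lower bound, so its tail is the whole series and its
    entries are \<open>v\<close> in every column.\<close>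
  define B where "B = (\<lambda>i j. if i < n then G (k i - l j) else v)"
  have length: "length la = Suc n" "length kap = n"
    using la kap by (auto simp: signatures_def)
  have e_sub: "e summable_on A" for A
    using e has_sum_imp_summable summable_on_subset_banach by blast
  then have G: "(e has_sum G m) {m..}" for m
    by (simp add: G_def)
  have shifted: "((\<lambda>t. e (t - l j)) has_sum G (m - l j)) {m..}" for m j
    using G[of "m - l j"]
    by (subst has_sum_reindex_bij_witness[of _ "\<lambda>t. t + l j" "\<lambda>t. t - l j"]) auto
  have shifted_UNIV: "((\<lambda>t. e (t - l j)) has_sum v) UNIV" for j
    using e by (subst has_sum_reindex_bij_witness[of _ "\<lambda>t. t + l j" "\<lambda>t. t - l j"]) auto
  have B: "((\<lambda>t. e (t - l j)) has_sum B i j) {t. i < n \<longrightarrow> k i \<le> t}" for i j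
    using shifted[of j "k i"] shifted_UNIV[of j] by (auto simp: B_def atLeast_def)
  have rows: "((\<lambda>t. e (t - l j)) has_sum (if 0 < i then B i j - B (i - 1) j else B i j))
      {t. (i < n \<longrightarrow> k i \<le> t) \<and> (0 < i \<longrightarrow> t < k (i - 1))}" if "i \<le> n" for i j
  proof (cases i)
    case 0
    then show ?thesis using B[where i = 0] by auto
  next
    case (Suc i')
    then have "k i \<le> k i'" if "i < n"
      using signatures_nth_mono[OF kap, of i' i] that by (auto simp: k_def)
    \<comment> \<open>The range of row \<open>i\<close> is the difference of two nested tails, so
      its sum is a difference of consecutive rows of \<open>B\<close>.\<close>
    then have "{t. i' < n \<longrightarrow> k i' \<le> t} \<subseteq> {t. i < n \<longrightarrow> k i \<le> t}"
      using Suc \<open>i \<le> n\<close> by auto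
    from has_sum_Diff[OF B B this, of j]
    have "((\<lambda>t. e (t - l j)) has_sum (B i j - B i' j))
        ({t. i < n \<longrightarrow> k i \<le> t} - {t. i' < n \<longrightarrow> k i' \<le> t})" .
    also have "{t. i < n \<longrightarrow> k i \<le> t} - {t. i' < n \<longrightarrow> k i' \<le> t} =
        {t. (i < n \<longrightarrow> k i \<le> t) \<and> (0 < i \<longrightarrow> t < k (i - 1))}"
      using Suc \<open>i \<le> n\<close> by auto
    finally show ?thesis
      using Suc by simp
  qed
  have "det (mat (Suc n) (Suc n) (\<lambda>(i, j). if 0 < i then B i j - B (i - 1) j else B i j)) =
      det (mat (Suc n) (Suc n) (\<lambda>(i, j). B i j))"
    by (rule det_consecutive_row_differences)
  also have "\<dots> = v * det (mat n n (\<lambda>(i, j). B i j - B i (Suc j)))"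
    by (rule det_last_row_constant) (simp add: B_def)
  also have "mat n n (\<lambda>(i, j). B i j - B i (Suc j)) =
      mat n n (\<lambda>(i, j). \<Sum>t = la ! Suc j - int j..la ! j - int j. e (k i - t))"
  proof (rule cong_mat; clarify)
    fix i j assume i: "i < n" and j: "j < n"
    have "la ! Suc j \<le> la ! j"
      using signatures_nth_mono[OF la] j by simp
    then have sub: "{k i - l (Suc j)..} \<subseteq> {k i - l j..}"
      by (auto simp: l_def)
    have "(e has_sum (G (k i - l j) - G (k i - l (Suc j)))) ({k i - l j..} - {k i - l (Suc j)..})"
      by (rule has_sum_Diff[OF G G sub])
    also have "{k i - l j..} - {k i - l (Suc j)..} = {k i - l j..<k i - l (Suc j)}"
      by auto
    finally have "G (k i - l j) - G (k i - l (Suc j)) = (\<Sum>m = k i - l j..<k i - l (Suc j). e m)"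
      by (simp add: has_sum_finite_iff)
    \<comment> \<open>Reflection gives \<open>l (Suc j) < t \<le> l j\<close>; since
      \<open>l (Suc j) = la ! Suc j - int j - 1\<close>, this is the closed interval of
      \<open>sum_det_interlaces_below\<close>.\<close>
    also have "\<dots> = (\<Sum>t = la ! Suc j - int j..la ! j - int j. e (k i - t))"
      by (rule sum.reindex_bij_witness[of _ "\<lambda>t. k i - t" "\<lambda>t. k i - t"]) (auto simp: l_def)
    finally show "B i j - B i (Suc j) = (\<Sum>t = la ! Suc j - int j..la ! j - int j. e (k i - t))"
      using i by (simp add: B_def)
  qed
  also have "det \<dots> = (\<Sum>th | interlaces th la. det (mat n n (\<lambda>(i, j). e (k i - (th ! j - int j)))))"
    by (rule sum_det_interlaces_below[OF length(1), symmetric])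
  finally have eq: "det (mat (Suc n) (Suc n) (\<lambda>(i, j). if 0 < i then B i j - B (i - 1) j else B i j)) =
      v * (\<Sum>th | interlaces th la. det (mat n n (\<lambda>(i, j). e (k i - (th ! j - int j)))))" .
  show ?thesis
    using has_sum_det_interlaces_above[OF length(2), of "\<lambda>j t. e (t - l j)"
        "\<lambda>i j. if 0 < i then B i j - B (i - 1) j else B i j"] rows eq
    by (simp add: k_def l_def algebra_simps)
qed

lemma prod_powi_nth:
  fixes y :: "'a::field"
  assumes "y \<noteq> 0" "length mu = n"
  shows "(\<Prod>i<n. y powi (mu ! i - int i)) = y powi (sum_list mu - int (\<Sum>i<n. i))"
proof -
  have "(\<Prod>i<n. y powi (f i)) = y powi (\<Sum>i<n. f i)" for f
    using assms(1) by (induction n) (auto simp: power_int_add)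
  then show ?thesis
    using assms(2) by (simp add: sum_subtractf sum_list_sum_nth atLeast0LessThan)
qed

text \<open>The power of \<open>y\<close> splits into a row factor and a column factor; in the total
  exponent the offsets \<open>- int i\<close> and \<open>+ int j\<close> cancel.\<close>

lemma det_shifted_powi:
  fixes c :: "int \<Rightarrow> 'a::field"
  assumes y: "y \<noteq> 0" and length: "length mu = n" "length la = n"
  shows "det (mat n n (\<lambda>(i, j). c (mu ! i - int i - la ! j + int j) *
      y powi (mu ! i - int i - la ! j + int j))) =
    y powi (sum_list mu - sum_list la) * det (mat n n (\<lambda>(i, j). c (mu ! i - int i - la ! j + int j)))"
proof -
  have "(\<Prod>j<n. inverse (y powi (la ! j - int j))) = inverse (y powi (sum_list la - int (\<Sum>i<n. i)))"
    using prod_inversef[of "\<lambda>j. y powi (la ! j - int j)" "{..<n}"]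
    by (simp add: o_def prod_powi_nth[OF y length(2)])
  moreover have "mat n n (\<lambda>(i, j). c (mu ! i - int i - la ! j + int j) * y powi (mu ! i - int i - la ! j + int j)) =
     mat n n (\<lambda>(i, j). y powi (mu ! i - int i) * inverse (y powi (la ! j - int j)) * c (mu ! i - int i - la ! j + int j))"
  proof (rule cong_mat; clarify)
    fix i j
    have "y powi (mu ! i - int i - la ! j + int j) = y powi (mu ! i - int i) * inverse (y powi (la ! j - int j))"
      using y power_int_diff[of y "mu ! i - int i" "la ! j - int j"] by (simp add: divide_inverse algebra_simps)
    then show "c (mu ! i - int i - la ! j + int j) * y powi (mu ! i - int i - la ! j + int j) =
      y powi (mu ! i - int i) * inverse (y powi (la ! j - int j)) * c (mu ! i - int i - la ! j + int j)"
      by (simp add: mult_ac)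
  qed
  moreover have "y powi (sum_list mu - int (\<Sum>i<n. i)) * inverse (y powi (sum_list la - int (\<Sum>i<n. i))) =
      y powi (sum_list mu - sum_list la)"
    using y by (simp add: power_int_diff field_simps)
  ultimately show ?thesis
    by (simp add: det_rows_cols_scaled prod_powi_nth[OF y length(1)])
qed

subsection \<open>Positivity of Schur functions\<close>

text \<open>The variable \<open>x\<^sub>0\<close> is excluded because nothing is known about the sign of \<open>\<xi> 0\<close>.\<close>

inductive monomial_positive :: "laurent_poly \<Rightarrow> bool" where
  single: "0 \<notin> Poly_Mapping.keys m \<Longrightarrow> monomial_positive (Poly_Mapping.single m 1)"
| add: "monomial_positive p \<Longrightarrow> monomial_positive q \<Longrightarrow> monomial_positive (p + q)"

text \<open>Nonnegative coefficients cannot cancel, so a sum of two such nonzero polynomials stays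
  nonzero.\<close>

lemma monomial_positive_imp:
  assumes "monomial_positive p"
  shows "p \<noteq> 0 \<and> (\<forall>m. 0 \<le> Poly_Mapping.lookup p m) \<and>
    (\<forall>m\<in>Poly_Mapping.keys p. 0 \<notin> Poly_Mapping.keys m)"
  using assms
proof induction
  case (single m)
  then show ?case
    by (simp add: lookup_single when_def flip: keys_eq_empty)
next
  case (add p q)
  have "p + q \<noteq> 0"
  proof
    assume "p + q = 0"
    then have sum: "Poly_Mapping.lookup p m + Poly_Mapping.lookup q m = 0" for m
      by (metis lookup_add lookup_zero)
    have "Poly_Mapping.lookup p m = 0" for m
      using sum[of m] add.IH by (smt (verit))
    then have "p = 0"
      by (intro poly_mapping_eqI) simp
    with add.IH show False by simp
  qed
  moreover have "\<forall>m\<in>Poly_Mapping.keys (p + q). 0 \<notin> Poly_Mapping.keys m"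
    using add.IH Poly_Mapping.keys_add[of p q] by blast
  ultimately show ?case
    using add.IH by (simp add: lookup_add)
qed

lemma laurent_eval_pos:
  assumes "monomial_positive p" and x: "\<And>i. i \<ge> 1 \<Longrightarrow> x i > 0"
  shows "laurent_eval x p > 0"
  unfolding laurent_eval_def
proof (rule sum_pos)
  note p = monomial_positive_imp[OF assms(1)]
  show "finite (Poly_Mapping.keys p)" "Poly_Mapping.keys p \<noteq> {}"
    using p by auto
  fix m assume m: "m \<in> Poly_Mapping.keys p"
  have "Poly_Mapping.lookup p m > 0"
    using p m by (simp add: in_keys_iff less_le)
  moreover have "x i powi Poly_Mapping.lookup m i > 0" if "i \<in> Poly_Mapping.keys m" for i
  proof (rule zero_less_power_int, rule x)
    show "1 \<le> i"
      using p m that by (cases i) auto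
  qed
  ultimately show "0 < Poly_Mapping.lookup p m * (\<Prod>i\<in>Poly_Mapping.keys m. x i powi Poly_Mapping.lookup m i)"
    by (simp add: prod_pos)
qed

lemma monomial_positive_lvar_powi_mult:
  assumes "monomial_positive p" "i \<ge> 1"
  shows "monomial_positive (lvar_powi i k * p)"
  using assms(1)
proof induction
  case (single m)
  have "0 \<notin> Poly_Mapping.keys (Poly_Mapping.single i k + m)"
    using single \<open>i \<ge> 1\<close> by (auto simp: in_keys_iff lookup_add lookup_single when_def)
  then show ?case
    by (simp add: lvar_powi_def mult_single monomial_positive.single)
next
  case (add p q)
  then show ?case
    by (simp add: ring_distribs monomial_positive.add)
qed

lemma monomial_positive_sum:
  assumes "finite I" "I \<noteq> {}" "\<And>i. i \<in> I \<Longrightarrow> monomial_positive (f i)"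
  shows "monomial_positive (\<Sum>i\<in>I. f i)"
  using assms by (induction I rule: finite_ne_induct) (auto intro: monomial_positive.add)

section \<open>Vandermonde products, alternants and branching\<close>

lemma lvar_powi_mult: "lvar_powi i a * lvar_powi i b = lvar_powi i (a + b)"
  by (simp add: lvar_powi_def mult_single single_add)

lemma lvar_powi_0 [simp]: "lvar_powi i 0 = 1"
  by (simp add: lvar_powi_def)

lemma prod_lvar_powi: "(\<Prod>j<(n::nat). lvar_powi i (f j)) = lvar_powi i (\<Sum>j<n. f j)"
  by (induction n) (simp_all add: lvar_powi_mult)

lemma lvar_diff_nonzero:
  assumes "i \<noteq> j"
  shows "lvar_powi i 1 - lvar_powi j 1 \<noteq> 0"
proof
  assume "lvar_powi i 1 - lvar_powi j 1 = 0"
  then have "Poly_Mapping.lookup (lvar_powi i 1) (Poly_Mapping.single i 1) =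
      Poly_Mapping.lookup (lvar_powi j 1) (Poly_Mapping.single i 1)"
    by simp
  then have "Poly_Mapping.single j (1::int) = Poly_Mapping.single i 1"
    by (simp add: lvar_powi_def lookup_single when_def split: if_splits)
  then have "Poly_Mapping.lookup (Poly_Mapping.single j (1::int)) i = Poly_Mapping.lookup (Poly_Mapping.single i 1) i"
    by simp
  with assms show False
    by (simp add: lookup_single)
qed

definition vandermonde :: "nat \<Rightarrow> laurent_poly" where
  "vandermonde N = (\<Prod>(i, j)\<in>{(i, j). 1 \<le> i \<and> i < j \<and> j \<le> N}. lvar_powi i 1 - lvar_powi j 1)"

definition alternant :: "nat \<Rightarrow> int list \<Rightarrow> laurent_poly" where
  "alternant N la = det (mat N N (\<lambda>(i, j). lvar_powi (Suc i) (la ! j + int N - int (Suc j))))"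

lemma finite_vandermonde_pairs: "finite {(i, j). 1 \<le> i \<and> i < j \<and> j \<le> (N::nat)}"
  by (rule finite_subset[of _ "{..N} \<times> {..N}"]) auto

lemma vandermonde_nonzero: "vandermonde N \<noteq> 0"
  unfolding vandermonde_def
  by (subst prod_zero_iff[OF finite_vandermonde_pairs]) (auto simp: lvar_diff_nonzero[unfolded right_minus_eq])

lemma vandermonde_Suc:
  "vandermonde (Suc n) = vandermonde n * (\<Prod>i<n. lvar_powi (Suc i) 1 - lvar_powi (Suc n) 1)"
proof -
  have "{(i, j). 1 \<le> i \<and> i < j \<and> j \<le> Suc n} =
      {(i, j). 1 \<le> i \<and> i < j \<and> j \<le> n} \<union> {Suc 0..n} \<times> {Suc n}"
    by (auto simp: le_Suc_eq)
  moreover have finite_col: "finite ({Suc 0..n} \<times> {Suc n})"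
    and disjoint: "{(i, j). 1 \<le> i \<and> i < j \<and> j \<le> n} \<inter> {Suc 0..n} \<times> {Suc n} = {}"
    by auto
  ultimately have "vandermonde (Suc n) = vandermonde n *
      (\<Prod>(i, j)\<in>{Suc 0..n} \<times> {Suc n}. lvar_powi i 1 - lvar_powi j 1)"
    unfolding vandermonde_def
    by (simp only: prod.union_disjoint[OF finite_vandermonde_pairs finite_col disjoint])
  also have "(\<Prod>(i, j)\<in>{Suc 0..n} \<times> {Suc n}. lvar_powi i 1 - lvar_powi j 1) =
      (\<Prod>i<n. lvar_powi (Suc i) 1 - lvar_powi (Suc n) 1)"
    by (simp add: prod.atLeast1_atMost_eq flip: prod.cartesian_product)
  finally show ?thesis .
qed

lemma sum_telescope_int:
  fixes w :: "int \<Rightarrow> 'a::ab_group_add"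
  assumes "a \<le> b + 1"
  shows "(\<Sum>t = a..b. w (t + 1) - w t) = w (b + 1) - w a"
  using assms
proof (induction "nat (b + 1 - a)" arbitrary: b)
  case 0
  then have "b + 1 = a" by simp
  then show ?case by auto
next
  case (Suc k)
  then have "a \<le> b" by simp
  then have "{a..b} = insert b {a..b - 1}" by auto
  then show ?case
    using Suc.hyps(1)[of "b - 1"] Suc.hyps(2) \<open>a \<le> b\<close> by simp
qed

lemma sum_list_eq_sum: "length xs = n \<Longrightarrow> (\<Sum>j<n. xs ! j) = sum_list xs"
  by (simp add: sum_list_sum_nth atLeast0LessThan)

text \<open>
  Dehomogenising each column by the last variable makes the last row constant, and after taking
  consecutive column differences each row is divisible by \<open>x\<^sub>i - x\<^sub>N\<close>, with geometric sums over the
  interlacing entries as quotients.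
\<close>

lemma alternant_branching:
  assumes la: "la \<in> signatures (Suc n)"
  shows "alternant (Suc n) la = (\<Prod>i<n. lvar_powi (Suc i) 1 - lvar_powi (Suc n) 1) *
    (\<Sum>mu | interlaces mu la. lvar_powi (Suc n) (sum_list la - sum_list mu) * alternant n mu)"
proof -
  define y where "y = lvar_powi (Suc n)"
  \<comment> \<open>This is the \<open>k\<close>-th power of the ratio of row variable
    \<open>Suc i\<close> to the last variable; for \<open>i = n\<close> it is 1.\<close>
  define z where "z = (\<lambda>i k. lvar_powi (Suc i) k * y (- k))"
  define p where "p = (\<lambda>j. la ! j + int n - int j)"
  have length: "length la = Suc n"
    using la by (simp add: signatures_def)
  have y_mult: "y a * y b = y (a + b)" for a b
    by (simp add: y_def lvar_powi_mult)
  have z_diff: "z i (k + 1) - z i k = (lvar_powi (Suc i) 1 - y 1) * (y (- 1) * z i k)" for i k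
  proof -
    have "(lvar_powi (Suc i) 1 - y 1) * (y (- 1) * z i k) =
        (lvar_powi (Suc i) 1 * lvar_powi (Suc i) k) * (y (- 1) * y (- k)) -
        lvar_powi (Suc i) k * (y 1 * y (- 1) * y (- k))"
      by (simp add: z_def algebra_simps)
    also have "\<dots> = z i (k + 1) - z i k"
      by (simp add: y_mult lvar_powi_mult z_def add.commute)
    finally show ?thesis ..
  qed
  \<comment> \<open>With this shift the exponent at \<open>t = mu ! j - int j\<close> is
    \<open>mu ! j + int n - int (Suc j)\<close>, exactly the one in
    \<open>alternant n mu\<close>.\<close>
  define q where "q = (\<lambda>i t. z i (t + int n - 1))"
  have "alternant (Suc n) la = det (mat (Suc n) (Suc n) (\<lambda>(i, j). 1 * y (p j) * z i (p j)))"
    unfolding alternant_def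
  proof (intro arg_cong[where f = det] cong_mat; clarify)
    fix i j
    have "y (p j) * y (- p j) = 1"
      by (simp add: y_mult) (simp add: y_def)
    then have "lvar_powi (Suc i) (p j) = 1 * y (p j) * z i (p j)"
      by (simp add: z_def mult.left_commute)
    then show "lvar_powi (Suc i) (la ! j + int (Suc n) - int (Suc j)) = 1 * y (p j) * z i (p j)"
      by (simp add: p_def algebra_simps)
  qed
  also have "\<dots> = (\<Prod>j<Suc n. y (p j)) * det (mat (Suc n) (Suc n) (\<lambda>(i, j). z i (p j)))"
    by (subst det_rows_cols_scaled) simp
  also have "det (mat (Suc n) (Suc n) (\<lambda>(i, j). z i (p j))) =
      det (mat n n (\<lambda>(i, j). z i (p j) - z i (p (Suc j))))"
    by (subst det_last_row_constant[where v = 1]) (simp_all add: z_def y_def lvar_powi_mult)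
  also have "mat n n (\<lambda>(i, j). z i (p j) - z i (p (Suc j))) =
      mat n n (\<lambda>(i, j). (lvar_powi (Suc i) 1 - y 1) * y (- 1) *
        (\<Sum>t = la ! Suc j - int j..la ! j - int j. q i t))"
  proof (rule cong_mat; clarify)
    fix i j assume "j < n"
    then have "la ! Suc j \<le> la ! j"
      using signatures_nth_mono[OF la] by simp
    then have "(\<Sum>t = la ! Suc j - int j..la ! j - int j. z i (t + 1 + int n - 1) - z i (t + int n - 1)) =
        z i (la ! j - int j + 1 + int n - 1) - z i (la ! Suc j - int j + int n - 1)"
      by (intro sum_telescope_int[where w = "\<lambda>t. z i (t + int n - 1)"]) simp
    also have "\<dots> = z i (p j) - z i (p (Suc j))"
      by (simp add: p_def algebra_simps)
    finally have "z i (p j) - z i (p (Suc j)) =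
        (\<Sum>t = la ! Suc j - int j..la ! j - int j. z i (t + 1 + int n - 1) - z i (t + int n - 1))" ..
    moreover have "z i (t + 1 + int n - 1) - z i (t + int n - 1) =
        (lvar_powi (Suc i) 1 - y 1) * y (- 1) * q i t" for t
    proof -
      have "t + 1 + int n - 1 = (t + int n - 1) + 1" by simp
      then show ?thesis
        by (simp only: z_diff q_def mult.assoc)
    qed
    ultimately show "z i (p j) - z i (p (Suc j)) = (lvar_powi (Suc i) 1 - y 1) * y (- 1) *
        (\<Sum>t = la ! Suc j - int j..la ! j - int j. q i t)"
      by (simp add: sum_distrib_left)
  qed
  also have "det \<dots> = (\<Prod>i<n. lvar_powi (Suc i) 1 - y 1) * (\<Prod>j<n. y (- 1)) *
      det (mat n n (\<lambda>(i, j). \<Sum>t = la ! Suc j - int j..la ! j - int j. q i t))"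
    by (rule det_rows_cols_scaled)
  also have "det (mat n n (\<lambda>(i, j). \<Sum>t = la ! Suc j - int j..la ! j - int j. q i t)) =
      (\<Sum>mu | interlaces mu la. det (mat n n (\<lambda>(i, j). q i (mu ! j - int j))))"
    by (rule sum_det_interlaces_below[OF length, symmetric])
  also have "(\<Prod>j<Suc n. y (p j)) * ((\<Prod>i<n. lvar_powi (Suc i) 1 - y 1) * (\<Prod>j<n. y (- 1)) *
      (\<Sum>mu | interlaces mu la. det (mat n n (\<lambda>(i, j). q i (mu ! j - int j))))) =
      (\<Prod>i<n. lvar_powi (Suc i) 1 - y 1) * (\<Sum>mu | interlaces mu la.
        (\<Prod>j<Suc n. y (p j)) * (\<Prod>j<n. y (- 1)) * det (mat n n (\<lambda>(i, j). q i (mu ! j - int j))))"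
    by (simp add: sum_distrib_left mult_ac)
  also have "(\<Sum>mu | interlaces mu la.
        (\<Prod>j<Suc n. y (p j)) * (\<Prod>j<n. y (- 1)) * det (mat n n (\<lambda>(i, j). q i (mu ! j - int j)))) =
      (\<Sum>mu | interlaces mu la. y (sum_list la - sum_list mu) * alternant n mu)"
  proof (intro sum.cong refl)
    fix mu assume "mu \<in> {mu. interlaces mu la}"
    then have mu: "length mu = n"
      using length by (simp add: interlaces_def)
    define r where "r = (\<lambda>j. mu ! j + int n - int (Suc j))"
    have "det (mat n n (\<lambda>(i, j). q i (mu ! j - int j))) =
        det (mat n n (\<lambda>(i, j). 1 * y (- r j) * lvar_powi (Suc i) (r j)))"
      by (intro arg_cong[where f = det] cong_mat) (auto simp: q_def z_def r_def algebra_simps)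
    also have "\<dots> = y (\<Sum>j<n. - r j) * alternant n mu"
      by (subst det_rows_cols_scaled) (simp add: y_def prod_lvar_powi alternant_def r_def)
    finally have "(\<Prod>j<Suc n. y (p j)) * (\<Prod>j<n. y (- 1)) * det (mat n n (\<lambda>(i, j). q i (mu ! j - int j))) =
        y (\<Sum>j<Suc n. p j) * y (\<Sum>j<n. - 1) * y (\<Sum>j<n. - r j) * alternant n mu"
      unfolding y_def prod_lvar_powi by (simp only: mult_ac)
    also have "\<dots> = y ((\<Sum>j<Suc n. p j) + (\<Sum>j<n. - 1) + (\<Sum>j<n. - r j)) * alternant n mu"
      by (simp only: y_mult)
    \<comment> \<open>The two staircase sums agree because the term \<open>j = n\<close> of the
      longer one is zero; the remaining shift by \<open>n\<close> cancels against the
      \<open>n\<close> factors \<open>y (- 1)\<close>.\<close>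
    also have "(\<Sum>j<Suc n. p j) + (\<Sum>j<n. - 1) + (\<Sum>j<n. - r j) = sum_list la - sum_list mu"
    proof -
      have "(\<Sum>j<Suc n. p j) = sum_list la + (\<Sum>j<Suc n. int n - int j)"
        by (simp add: p_def sum_list_eq_sum[OF length, symmetric] sum.distrib algebra_simps sum_subtractf)
      moreover have "(\<Sum>j<n. r j) = sum_list mu + (\<Sum>j<n. int n - int j) + (\<Sum>j<n. - 1)"
        by (simp add: r_def sum_list_eq_sum[OF mu, symmetric] sum.distrib algebra_simps sum_subtractf)
      ultimately show ?thesis
        by (simp add: sum_negf)
    qed
    finally show "(\<Prod>j<Suc n. y (p j)) * (\<Prod>j<n. y (- 1)) * det (mat n n (\<lambda>(i, j). q i (mu ! j - int j))) =
        y (sum_list la - sum_list mu) * alternant n mu" .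
  qed
  finally show ?thesis
    by (simp add: y_def)
qed

lemma interlaces_below_signature:
  assumes "la \<in> signatures (Suc n)" "interlaces mu la"
  shows "mu \<in> signatures n"
proof -
  have n: "n = length mu"
    using assms by (simp add: interlaces_def signatures_def)
  have "mu ! j \<le> mu ! i" if "i < j" "j < n" for i j
  proof -
    have "mu ! j \<le> la ! j"
      using assms(2) that n by (simp add: interlaces_def)
    also have "\<dots> \<le> la ! Suc i"
      using signatures_nth_mono[OF assms(1), of "Suc i" j] that by simp
    also have "\<dots> \<le> mu ! i"
      using assms(2) that n by (simp add: interlaces_def)
    finally show ?thesis .
  qed
  then show ?thesis
    using assms by (auto simp: interlaces_def signatures_def sorted_wrt_iff_nth_less)
qed

text \<open>With \<open>interlaces_below_signature\<close> this places every list that interlaces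
  with a given signature among the signatures, so the link restricts both sums of the theorem to
  interlacing lists.\<close>

lemma interlaces_above_signature:
  assumes "kap \<in> signatures n" "interlaces kap mu"
  shows "mu \<in> signatures (Suc n)"
proof -
  have "mu ! j \<le> mu ! i" if "i < j" "j < Suc n" for i j
  proof -
    have "mu ! Suc j' \<le> kap ! j'" if "j' < n" for j'
      using assms that by (simp add: interlaces_def signatures_def)
    from this[of "j - 1"] have "mu ! j \<le> kap ! (j - 1)"
      using that by simp
    also have "\<dots> \<le> kap ! i"
      using signatures_nth_mono[OF assms(1), of i "j - 1"] that by simp
    also have "\<dots> \<le> mu ! i"
      using assms that by (auto simp: interlaces_def signatures_def)
    finally show ?thesis .
  qed
  then show ?thesis
    using assms by (auto simp: interlaces_def signatures_def sorted_wrt_iff_nth_less)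
qed

text \<open>Makes the branching sum nonempty, as positivity requires.\<close>

lemma ex_interlaces_below:
  assumes "la \<in> signatures (Suc n)"
  shows "\<exists>mu. interlaces mu la"
  using assms signatures_nth_mono[OF assms]
  by (intro exI[of _ "tl la"]) (auto simp: interlaces_def signatures_def nth_tl)

text \<open>The product of differences in \<open>alternant_branching\<close> is the factor by which
  the Vandermonde product grows, so the quotients obey the branching rule; its coefficients are
  monomials, which preserves positivity.\<close>

lemma ex_monomial_positive:
  "la \<in> signatures N \<Longrightarrow> \<exists>s. monomial_positive s \<and> s * vandermonde N = alternant N la"
proof (induction N arbitrary: la)
  case 0
  have "monomial_positive 1"
    using monomial_positive.single[of 0] by simp
  moreover have "vandermonde 0 = 1"
    by (auto simp: vandermonde_def intro!: prod.neutral)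
  ultimately show ?case
    by (intro exI[of _ 1]) (simp add: alternant_def)
next
  case (Suc n)
  then have "\<forall>mu\<in>{mu. interlaces mu la}. \<exists>s. monomial_positive s \<and> s * vandermonde n = alternant n mu"
    using interlaces_below_signature by blast
  then obtain s where s: "\<And>mu. interlaces mu la \<Longrightarrow> monomial_positive (s mu)"
      "\<And>mu. interlaces mu la \<Longrightarrow> s mu * vandermonde n = alternant n mu"
    unfolding bchoice_iff by blast
  let ?S = "\<Sum>mu | interlaces mu la. lvar_powi (Suc n) (sum_list la - sum_list mu) * s mu"
  have "monomial_positive ?S"
    using finite_interlaces_below ex_interlaces_below[OF Suc.prems] s(1)
    by (intro monomial_positive_sum) (auto intro!: monomial_positive_lvar_powi_mult)
  moreover have "?S * vandermonde (Suc n) = alternant (Suc n) la"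
    unfolding alternant_branching[OF Suc.prems] vandermonde_Suc
    by (simp add: sum_distrib_left sum_distrib_right s(2)[symmetric] mult_ac)
  ultimately show ?case by blast
qed

text \<open>Laurent polynomials form an integral domain, so the quotient by the Vandermonde product
  is unique and the description in \<open>rational_schur\<close> denotes the positive one just
  found.\<close>

lemma schur_value_pos:
  assumes "\<And>i. i \<ge> 1 \<Longrightarrow> \<xi> i > 0" "la \<in> signatures N"
  shows "schur_value \<xi> N la > 0"
proof -
  obtain s where s: "monomial_positive s" "s * vandermonde N = alternant N la"
    using ex_monomial_positive[OF assms(2)] by blast
  have "rational_schur N la = s"
    unfolding rational_schur_def vandermonde_def[symmetric] alternant_def[symmetric]
  proof (rule the_equality)
    fix s' assume "s' * vandermonde N = alternant N la"
    then have "s' * vandermonde N = s * vandermonde N"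
      using s(2) by simp
    then show "s' = s"
      by (rule mult_right_cancel[OF vandermonde_nonzero, THEN iffD1])
  qed (rule s(2))
  then show ?thesis
    using laurent_eval_pos[OF s(1)] assms(1) by (simp add: schur_value_def)
qed

subsection \<open>Laurent coefficients\<close>

text \<open>The property by which \<open>laurent_coeff\<close> is described, with free radii so that
  an expansion can be restricted to a smaller annulus.\<close>

definition laurent_expansion_on :: "real \<Rightarrow> real \<Rightarrow> (int \<Rightarrow> real) \<Rightarrow> (complex \<Rightarrow> complex) \<Rightarrow> bool" where
  "laurent_expansion_on a b c g \<longleftrightarrow> (\<forall>x. a \<le> norm x \<and> norm x \<le> b \<longrightarrow>
    ((\<lambda>k. of_real (c k) * x powi k) has_sum g x) UNIV)"

lemma laurent_expansion_onI:
  assumes "\<And>x. a \<le> norm x \<Longrightarrow> norm x \<le> b \<Longrightarrow> ((\<lambda>k. of_real (c k) * x powi k) has_sum g x) UNIV"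
  shows "laurent_expansion_on a b c g"
  using assms by (simp add: laurent_expansion_on_def)

lemma laurent_expansion_onD:
  assumes "laurent_expansion_on a b c g" "a \<le> norm x" "norm x \<le> b"
  shows "((\<lambda>k. of_real (c k) * x powi k) has_sum g x) UNIV"
  using assms by (simp add: laurent_expansion_on_def)

lemma has_sum_imp_abs_summable_complex:
  fixes f :: "'a \<Rightarrow> complex"
  shows "(f has_sum s) A \<Longrightarrow> f abs_summable_on A"
  using has_sum_imp_summable summable_on_iff_abs_summable_on_complex by blast

text \<open>Cauchy product of bilateral series: absolute convergence allows the double series to be
  regrouped by total degree \<open>k = i + j\<close>.\<close>

lemma laurent_expansion_on_mult:
  assumes a: "0 < a" "a \<le> b"
    and f: "laurent_expansion_on a b c f" and g: "laurent_expansion_on a b d g"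
  shows "laurent_expansion_on a b (\<lambda>k. \<Sum>\<^sub>\<infinity>j. c j * d (k - j)) (\<lambda>x. f x * g x)"
proof -
  define e where "e = (\<lambda>k. \<Sum>\<^sub>\<infinity>j. c j * d (k - j))"
  have pairs: "((\<lambda>(k, j). of_real (c j * d (k - j)) * x powi k) has_sum f x * g x) (UNIV \<times> UNIV)"
    if x: "a \<le> norm x" "norm x \<le> b" for x
  proof -
    have "x \<noteq> 0"
      using x a by auto
    have "((\<lambda>(i, j). (of_real (c i) * x powi i) * (of_real (d j) * x powi j)) has_sum f x * g x) (UNIV \<times> UNIV)"
      using laurent_expansion_onD[OF f x] laurent_expansion_onD[OF g x]
      by (intro has_sum_times has_sum_imp_abs_summable_complex)
    then show ?thesis
      by (subst has_sum_reindex_bij_witness[of _ "\<lambda>(i, j). (i + j, i)" "\<lambda>(k, j). (j, k - j)"])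
         (use \<open>x \<noteq> 0\<close> in \<open>auto simp: power_int_diff\<close>)
  qed
  \<comment> \<open>Each convolution is itself an infinite series; it converges because the double
    series does at the point \<open>a\<close>, after division by \<open>a powi k\<close>.\<close>
  have e: "((\<lambda>j. c j * d (k - j)) has_sum e k) UNIV" for k
  proof -
    have "(\<lambda>(k, j). of_real (c j * d (k - j)) * complex_of_real a powi k) summable_on Sigma UNIV (\<lambda>_. UNIV)"
      using pairs[of "of_real a"] a by (auto dest: has_sum_imp_summable)
    from summable_on_SigmaD1[OF this, of k]
    have "(\<lambda>j. complex_of_real (c j * d (k - j)) * of_real a powi k) summable_on UNIV"
      by simp
    then have "(\<lambda>j. complex_of_real (c j * d (k - j))) summable_on UNIV"
      using a by (subst (asm) summable_on_cmult_left') auto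
    from summable_on_Re[OF this] show ?thesis
      by (simp add: e_def)
  qed
  show ?thesis
    unfolding e_def[symmetric]
  proof (rule laurent_expansion_onI)
    fix x :: complex assume x: "a \<le> norm x" "norm x \<le> b"
    show "((\<lambda>k. of_real (e k) * x powi k) has_sum f x * g x) UNIV"
      using pairs[OF x] by (rule has_sum_SigmaD) (use has_sum_cmult_left[OF has_sum_of_real[OF e]] in auto)
  qed
qed

section \<open>Expansions and positivity of admissible functions\<close>

lemma laurent_expansion_on_const_1: "laurent_expansion_on a b (\<lambda>k. if k = 0 then 1 else 0) (\<lambda>_. 1)"
  by (rule laurent_expansion_onI) (rule has_sum_finite_neutralI[of "{0}"], auto)

text \<open>Extension by zero to integer indices; the sign \<open>s\<close> covers series in
  \<open>x\<close> and in \<open>inverse x\<close> together.\<close>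

lemma has_sum_int_of_nat:
  fixes f :: "nat \<Rightarrow> 'a::topological_comm_monoid_add"
  assumes s: "s = 1 \<or> s = - 1" and f: "(f has_sum v) UNIV"
  shows "((\<lambda>k. if 0 \<le> s * k then f (nat (s * k)) else 0) has_sum v) (UNIV :: int set)"
proof -
  have ss: "s * (s * k) = k" for k
    using s by auto
  have "((\<lambda>k. f (nat (s * k))) has_sum v) {k. 0 \<le> s * k}"
    using f by (subst has_sum_reindex_bij_witness[of _ "\<lambda>n. s * int n" "\<lambda>k. nat (s * k)"]) (auto simp: ss)
  then show ?thesis
    by (rule has_sum_cong_neutral[THEN iffD1, rotated -1]) auto
qed

lemma laurent_expansion_on_power_series:
  assumes "\<And>x. a \<le> norm x \<Longrightarrow> norm x \<le> b \<Longrightarrow> ((\<lambda>n. of_real (c n) * x ^ n) has_sum g x) UNIV"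
  shows "\<exists>c. laurent_expansion_on a b c g"
proof (intro exI laurent_expansion_onI)
  fix x :: complex assume "a \<le> norm x" "norm x \<le> b"
  from has_sum_int_of_nat[OF _ assms[OF this], of 1]
  show "((\<lambda>k. of_real (if 0 \<le> k then c (nat k) else 0) * x powi k) has_sum g x) UNIV"
    by (rule has_sum_cong[THEN iffD1, rotated]) (auto simp: power_int_def)
qed

lemma laurent_expansion_on_inverse_power_series:
  assumes "\<And>x. a \<le> norm x \<Longrightarrow> norm x \<le> b \<Longrightarrow> ((\<lambda>n. of_real (c n) * inverse x ^ n) has_sum g x) UNIV"
  shows "\<exists>c. laurent_expansion_on a b c g"
proof (intro exI laurent_expansion_onI)
  fix x :: complex assume "a \<le> norm x" "norm x \<le> b"
  from has_sum_int_of_nat[OF _ assms[OF this], of "- 1"]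
  show "((\<lambda>k. of_real (if k \<le> 0 then c (nat (- k)) else 0) * x powi k) has_sum g x) UNIV"
    by (rule has_sum_cong[THEN iffD1, rotated]) (auto simp: power_int_def)
qed

lemma has_sum_linear: "((\<lambda>n. of_real (if n = 0 then p else if n = 1 then q else 0) * x ^ n) has_sum
    (of_real p + of_real q * x :: complex)) (UNIV :: nat set)"
  by (rule has_sum_finite_neutralI[of "{0, 1}"]) auto

lemma has_sum_exp: "((\<lambda>n. of_real (\<gamma> ^ n / fact n) * x ^ n) has_sum exp (of_real \<gamma> * x :: complex)) UNIV"
proof -
  have eq: "of_real (\<gamma> ^ n / fact n) * x ^ n = (of_real \<gamma> * x) ^ n /\<^sub>R fact n" for n
    by (simp add: power_mult_distrib scaleR_conv_of_real divide_inverse)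
  show ?thesis
    unfolding eq by (rule norm_summable_imp_has_sum[OF summable_norm_exp exp_converges])
qed

lemma has_sum_geometric:
  assumes "norm (of_real \<alpha> * x :: complex) < 1"
  shows "((\<lambda>n. of_real (\<alpha> ^ n) * x ^ n) has_sum inverse (1 - of_real \<alpha> * x)) UNIV"
proof -
  have eq: "of_real (\<alpha> ^ n) * x ^ n = (of_real \<alpha> * x) ^ n" for n
    by (simp add: power_mult_distrib)
  have "(\<lambda>n. (of_real \<alpha> * x) ^ n) sums inverse (1 - of_real \<alpha> * x)"
    using geometric_sums[OF assms] by (simp add: inverse_eq_divide)
  moreover have "summable (\<lambda>n. norm ((of_real \<alpha> * x) ^ n))"
    unfolding norm_power by (rule summable_geometric) (use assms in simp)
  ultimately show ?thesis
    unfolding eq by (intro norm_summable_imp_has_sum)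
qed

text \<open>Each factor is a power series in \<open>x\<close> or in \<open>inverse x\<close>; the
  strict bounds on \<alpha> make the geometric ones converge on the closed annulus, boundary
  included.\<close>

lemma elementary_fun_laurent_expansion:
  assumes f: "f \<in> elementary_fun N \<xi>" and \<xi>: "0 < \<xi> 1" "\<xi> 1 \<le> \<xi> N"
  shows "\<exists>c. laurent_expansion_on (\<xi> 1) (\<xi> N) c f"
proof -
  note pos = laurent_expansion_on_power_series and neg = laurent_expansion_on_inverse_power_series
  have small: "norm (of_real \<alpha> * x) < 1"
    if "0 < \<alpha>" "\<alpha> < inverse (\<xi> N)" "norm x \<le> \<xi> N" for \<alpha> and x :: complex
  proof -
    have "\<alpha> * norm x \<le> \<alpha> * \<xi> N"
      using that by simp
    also have "\<dots> < 1"
      using that \<xi> by (simp add: field_simps)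
    finally show ?thesis
      using that by (simp add: norm_mult)
  qed
  have small': "norm (of_real \<alpha> * inverse x) < 1"
    if "0 < \<alpha>" "\<alpha> < \<xi> 1" "\<xi> 1 \<le> norm x" for \<alpha> and x :: complex
  proof -
    have "\<alpha> / norm x < 1"
      using that by (subst divide_less_eq) auto
    then show ?thesis
      using that by (simp add: norm_mult norm_inverse divide_inverse)
  qed
  consider "f = (\<lambda>x. x)" | "f = inverse"
    | \<beta> where "f = (\<lambda>x. 1 + of_real \<beta> * x)" | \<beta> where "f = (\<lambda>x. 1 + of_real \<beta> * inverse x)"
    | \<gamma> where "f = (\<lambda>x. exp (of_real \<gamma> * x))" | \<gamma> where "f = (\<lambda>x. exp (of_real \<gamma> * inverse x))"
    | \<alpha> where "f = (\<lambda>x. inverse (1 - of_real \<alpha> * x))" "0 < \<alpha>" "\<alpha> < inverse (\<xi> N)"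
    | \<alpha> where "f = (\<lambda>x. inverse (1 - of_real \<alpha> * inverse x))" "0 < \<alpha>" "\<alpha> < \<xi> 1"
    using f unfolding elementary_fun_def by blast
  then show ?thesis
  proof cases
    case 1
    then show ?thesis
      using has_sum_linear[of 0 1] by (intro pos) simp
  next
    case 2
    then show ?thesis
      using has_sum_linear[of 0 1] by (intro neg) simp
  next
    case (3 \<beta>)
    then show ?thesis
      using has_sum_linear[of 1 \<beta>] by (intro pos) simp
  next
    case (4 \<beta>)
    then show ?thesis
      using has_sum_linear[of 1 \<beta>] by (intro neg) simp
  next
    case (5 \<gamma>)
    then show ?thesis
      by (simp only:) (rule pos, rule has_sum_exp)
  next
    case (6 \<gamma>)
    then show ?thesis
      by (simp only:) (rule neg, rule has_sum_exp)
  next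
    case (7 \<alpha>)
    show ?thesis
      unfolding 7(1) by (rule pos, rule has_sum_geometric, rule small[OF 7(2,3)])
  next
    case (8 \<alpha>)
    show ?thesis
      unfolding 8(1) by (rule neg, rule has_sum_geometric, rule small'[OF 8(2,3)])
  qed
qed

lemma elementary_fun_pos:
  assumes f: "f \<in> elementary_fun N \<xi>" and \<xi>: "0 < \<xi> 1" and r: "\<xi> 1 \<le> r" "r \<le> \<xi> N"
  shows "\<exists>v>0. f (of_real r) = of_real v"
proof -
  have r0: "0 < r"
    using \<xi> r by simp
  have less: "\<alpha> * r < 1" if "0 < \<alpha>" "\<alpha> < inverse (\<xi> N)" for \<alpha>
  proof -
    have "\<alpha> * r \<le> \<alpha> * \<xi> N"
      using that r by simp
    also have "\<dots> < 1"
      using that r r0 by (simp add: field_simps)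
    finally show ?thesis .
  qed
  consider "f = (\<lambda>x. x)" | "f = inverse"
    | \<beta> where "f = (\<lambda>x. 1 + of_real \<beta> * x)" "\<beta> > 0"
    | \<beta> where "f = (\<lambda>x. 1 + of_real \<beta> * inverse x)" "\<beta> > 0"
    | \<gamma> where "f = (\<lambda>x. exp (of_real \<gamma> * x))" | \<gamma> where "f = (\<lambda>x. exp (of_real \<gamma> * inverse x))"
    | \<alpha> where "f = (\<lambda>x. inverse (1 - of_real \<alpha> * x))" "0 < \<alpha>" "\<alpha> < inverse (\<xi> N)"
    | \<alpha> where "f = (\<lambda>x. inverse (1 - of_real \<alpha> * inverse x))" "0 < \<alpha>" "\<alpha> < \<xi> 1"
    using f unfolding elementary_fun_def by blast
  then show ?thesis
  proof cases
    case 1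
    then show ?thesis using r0 by (intro exI[of _ r]) simp
  next
    case 2
    then show ?thesis using r0 by (intro exI[of _ "inverse r"]) (simp add: of_real_inverse)
  next
    case (3 \<beta>)
    then show ?thesis using r0 by (intro exI[of _ "1 + \<beta> * r"]) (simp add: add_pos_pos)
  next
    case (4 \<beta>)
    then show ?thesis using r0
      by (intro exI[of _ "1 + \<beta> * inverse r"]) (simp add: add_pos_pos del: inverse_eq_divide)
  next
    case (5 \<gamma>)
    then show ?thesis by (intro exI[of _ "exp (\<gamma> * r)"]) (simp flip: exp_of_real)
  next
    case (6 \<gamma>)
    then show ?thesis by (intro exI[of _ "exp (\<gamma> * inverse r)"]) (simp flip: exp_of_real)
  next
    case (7 \<alpha>)
    then show ?thesis using less[of \<alpha>] by (intro exI[of _ "inverse (1 - \<alpha> * r)"]) simp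
  next
    case (8 \<alpha>)
    then have "\<alpha> * inverse r < 1"
      using r r0 by (simp add: field_simps)
    with 8 show ?thesis by (intro exI[of _ "inverse (1 - \<alpha> * inverse r)"]) simp
  qed
qed

lemma admissible_fun_laurent_expansion:
  assumes g: "g \<in> admissible_fun N \<xi>" and \<xi>: "0 < \<xi> 1" "\<xi> 1 \<le> \<xi> N"
  obtains c where "laurent_expansion_on (\<xi> 1) (\<xi> N) c g"
proof -
  have "\<exists>c. laurent_expansion_on (\<xi> 1) (\<xi> N) c (\<lambda>x. \<Prod>f\<leftarrow>fs. f x)"
    if "set fs \<subseteq> elementary_fun N \<xi>" for fs
    using that
  proof (induction fs)
    case Nil
    then show ?case using laurent_expansion_on_const_1 by auto
  next
    case (Cons f fs)
    then show ?case
      using laurent_expansion_on_mult[OF \<xi>] elementary_fun_laurent_expansion[OF _ \<xi>, of f] by fastforce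
  qed
  then show ?thesis
    using g that unfolding admissible_fun_def by blast
qed

text \<open>Positivity passes from the factors to the product. At \<open>\<xi> N\<close> it shows
  that \<open>Re\<close> loses nothing and that the normalising factor can be cancelled.\<close>

lemma admissible_fun_pos:
  assumes g: "g \<in> admissible_fun N \<xi>" and \<xi>: "0 < \<xi> 1" and r: "\<xi> 1 \<le> r" "r \<le> \<xi> N"
  obtains v where "v > 0" "g (of_real r) = of_real v"
proof -
  have "\<exists>v>0. (\<Prod>f\<leftarrow>fs. f (of_real r)) = (of_real v :: complex)" if "set fs \<subseteq> elementary_fun N \<xi>" for fs
    using that
  proof (induction fs)
    case Nil
    then show ?case by (intro exI[of _ 1]) simp
  next
    case (Cons f fs)
    then obtain u v where "u > 0" "f (of_real r) = of_real u" "v > 0" "(\<Prod>f\<leftarrow>fs. f (of_real r)) = (of_real v :: complex)"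
      using elementary_fun_pos[OF _ \<xi> r, of f] by auto
    then show ?case by (intro exI[of _ "u * v"]) simp
  qed
  then show ?thesis
    using g that unfolding admissible_fun_def by blast
qed

section \<open>Uniqueness of Laurent coefficients\<close>

text \<open>A geometric sum whose ratio \<open>z\<close> satisfies \<open>z ^ M = 1\<close>: it
  vanishes unless \<open>z = 1\<close>, that is, unless \<open>M\<close> divides
  \<open>m\<close>.\<close>

lemma sum_cis_roots_of_unity:
  assumes "M > 0"
  shows "(\<Sum>s<M. cis (of_int m * (2 * pi * real s / real M))) = (if int M dvd m then of_nat M else 0)"
proof -
  define z where "z = cis (2 * pi * of_int m / real M)"
  have power: "cis (of_int m * (2 * pi * real s / real M)) = z ^ s" for s
    by (simp add: z_def DeMoivre mult_ac)
  have z_M: "z ^ M = 1"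
    using assms cis_multiple_2pi[of "of_int m"] by (simp add: z_def DeMoivre mult_ac)
  show ?thesis
  proof (cases "int M dvd m")
    case True
    then obtain q where "m = int M * q" ..
    then have "z = 1"
      using assms cis_multiple_2pi[of "of_int q"] by (simp add: z_def mult_ac)
    with True show ?thesis
      unfolding power by simp
  next
    case False
    have "z \<noteq> 1"
    proof
      assume "z = 1"
      then have "cos (2 * pi * of_int m / real M) = 1"
        by (simp add: z_def complex_eq_iff)
      then obtain q :: int where "2 * pi * of_int m / real M = of_int q * 2 * pi"
        by (auto simp: cos_one_2pi_int)
      then have "real_of_int m = real_of_int (q * int M)"
        using assms by (simp add: field_simps)
      then have "m = q * int M"
        by (simp only: of_int_eq_iff)
      with False show False by simp
    qed
    then show ?thesis
      using False unfolding power by (simp add: geometric_sum z_M)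
  qed
qed

text \<open>
  Averaging over the \<open>M\<close>-th roots of unity isolates the coefficients in one residue class modulo
  \<open>M\<close>; for large \<open>M\<close> all of them but \<open>b n\<close> lie in the tail of the series.
\<close>

lemma trigonometric_series_zero:
  fixes b :: "int \<Rightarrow> complex"
  assumes zero: "\<And>t. ((\<lambda>k. b k * cis (of_int k * t)) has_sum 0) UNIV"
  shows "b n = 0"
proof (rule ccontr)
  assume "b n \<noteq> 0"
  have "(\<lambda>k. norm (b k)) summable_on UNIV"
    using has_sum_imp_abs_summable_complex[OF zero[of 0]] by simp
  then have norm_b: "((\<lambda>k. norm (b k)) has_sum infsum (\<lambda>k. norm (b k)) UNIV) UNIV"
    by simp
  obtain F where F: "finite F" "dist (\<Sum>k\<in>F. norm (b k)) (infsum (\<lambda>k. norm (b k)) UNIV) \<le> norm (b n) / 2"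
    using has_sum_finite_approximation[OF norm_b, of "norm (b n) / 2"] \<open>b n \<noteq> 0\<close> by auto
  \<comment> \<open>Larger than every distance from \<open>n\<close> to a point of \<open>F\<close>,
    so no other element of \<open>F\<close> is congruent to \<open>n\<close> modulo
    \<open>M\<close>.\<close>
  define M where "M = Suc (\<Sum>k\<in>F. nat \<bar>k - n\<bar>)"
  have not_dvd: "\<not> int M dvd k - n" if "k \<in> F" "k \<noteq> n" for k
  proof
    assume "int M dvd k - n"
    then have "int M \<le> \<bar>k - n\<bar>"
      using that(2) dvd_imp_le_int[of "k - n" "int M"] by simp
    moreover have "\<bar>k - n\<bar> \<le> (\<Sum>k\<in>F. \<bar>k - n\<bar>)"
      using F(1) that(1) by (intro member_le_sum) auto
    ultimately show False
      by (simp add: M_def)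
  qed
  define h where "h = (\<lambda>k. if int M dvd k - n then b k else 0)"
  define t where "t = (\<lambda>s. 2 * pi * real s / real M)"
  have "((\<lambda>k. \<Sum>s<M. cis (- of_int n * t s) * (b k * cis (of_int k * t s))) has_sum
      (\<Sum>s<M. cis (- of_int n * t s) * 0)) UNIV"
    by (intro has_sum_finite_sum has_sum_cmult_right zero) simp
  moreover have "(\<Sum>s<M. cis (- of_int n * t s) * (b k * cis (of_int k * t s))) = of_nat M * h k" for k
  proof -
    have "cis (- of_int n * t s) * (b k * cis (of_int k * t s)) = b k * cis (of_int (k - n) * t s)" for s
    proof -
      have "cis (- of_int n * t s) * (b k * cis (of_int k * t s)) =
          b k * (cis (- of_int n * t s) * cis (of_int k * t s))"
        by (simp only: mult_ac)
      then show ?thesis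
        by (simp add: cis_mult left_diff_distrib)
    qed
    then have "(\<Sum>s<M. cis (- of_int n * t s) * (b k * cis (of_int k * t s))) =
        b k * (\<Sum>s<M. cis (of_int (k - n) * t s))"
      by (simp only: sum_distrib_left)
    also have "\<dots> = of_nat M * h k"
      unfolding t_def by (subst sum_cis_roots_of_unity) (simp_all add: M_def h_def)
    finally show ?thesis .
  qed
  ultimately have "((\<lambda>k. of_nat M * h k) has_sum 0) UNIV"
    by simp
  moreover have "M \<noteq> 0"
    by (simp add: M_def)
  ultimately have "(h has_sum 0) UNIV"
    using has_sum_cmult_right_iff[where c = "of_nat M" and f = h and S = 0] by simp
  moreover have "(h has_sum b n) {n}"
    by (rule has_sum_finiteI) (simp_all add: h_def)
  \<comment> \<open>The whole residue class sums to zero, so its other terms must balance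
    \<open>b n\<close>.\<close>
  ultimately have h: "(h has_sum (0 - b n)) (UNIV - {n})"
    by (rule has_sum_Diff) simp
  then have norm_h: "((\<lambda>k. norm (h k)) has_sum infsum (\<lambda>k. norm (h k)) (UNIV - {n})) (UNIV - {n})"
    using has_sum_imp_abs_summable_complex[OF h] by simp
  have "norm (b n) \<le> infsum (\<lambda>k. norm (h k)) (UNIV - {n})"
    using norm_has_sum_bound[OF norm_h h] by simp
  \<comment> \<open>Away from \<open>n\<close>, \<open>h\<close> vanishes on \<open>F\<close>, and
    outside \<open>F\<close> its norm is at most that of \<open>b\<close>.\<close>
  also have "\<dots> \<le> infsum (\<lambda>k. norm (b k)) UNIV - (\<Sum>k\<in>F. norm (b k))"
  proof (rule has_sum_mono_neutral[OF norm_h])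
    show "((\<lambda>k. norm (b k)) has_sum (infsum (\<lambda>k. norm (b k)) UNIV - (\<Sum>k\<in>F. norm (b k)))) (UNIV - F)"
      using norm_b F(1) by (intro has_sum_Diff) auto
  qed (auto simp: h_def not_dvd)
  also have "\<dots> \<le> norm (b n) / 2"
    using F(2) unfolding dist_real_def by linarith
  finally show False
    using \<open>b n \<noteq> 0\<close> by simp
qed

text \<open>On the circle of radius \<open>r\<close> the difference of the expansions is a
  trigonometric series with sum zero. One circle is enough, which covers the degenerate annulus
  \<open>\<xi> 1 = \<xi> N\<close>.\<close>

lemma laurent_expansion_unique:
  fixes g :: "complex \<Rightarrow> complex"
  assumes r: "r > 0"
    and c: "\<And>x. norm x = r \<Longrightarrow> ((\<lambda>k. of_real (c k) * x powi k) has_sum g x) UNIV"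
    and d: "\<And>x. norm x = r \<Longrightarrow> ((\<lambda>k. of_real (d k) * x powi k) has_sum g x) UNIV"
  shows "c = d"
proof
  fix n
  have "((\<lambda>k. of_real ((c k - d k) * r powi k) * cis (of_int k * t)) has_sum 0) UNIV" for t
  proof -
    define x where "x = of_real r * cis t"
    have x: "norm x = r"
      using r by (simp add: x_def norm_mult)
    have "of_real ((c k - d k) * r powi k) * cis (of_int k * t) =
        of_real (c k) * x powi k - of_real (d k) * x powi k" for k
      by (simp add: x_def power_int_mult_distrib cis_power_int algebra_simps)
    then show ?thesis
      using has_sum_add[OF c[OF x] has_sum_uminusI[OF d[OF x]]] by simp
  qed
  then have "complex_of_real ((c n - d n) * r powi n) = 0"
    by (rule trigonometric_series_zero)
  then show "c n = d n"
    using r by simp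
qed

lemma laurent_coeff_eq:
  assumes "0 < \<xi> 1" "\<xi> 1 \<le> \<xi> N" and c: "laurent_expansion_on (\<xi> 1) (\<xi> N) c g"
  shows "laurent_coeff \<xi> N g = c"
  unfolding laurent_coeff_def
proof (rule the_equality)
  fix d assume "\<forall>x. \<xi> 1 \<le> norm x \<and> norm x \<le> \<xi> N \<longrightarrow> ((\<lambda>k. of_real (d k) * x powi k) has_sum g x) UNIV"
  then show "d = c"
    using assms by (intro laurent_expansion_unique[of "\<xi> 1" _ g]) (auto simp: laurent_expansion_on_def)
qed (use c in \<open>simp add: laurent_expansion_on_def\<close>)

subsection \<open>Commutation with the link\<close>

text \<open>An infinite sum defaults to 0 when it does not converge; the two summability claims
  exclude this reading of the equation.\<close>

theorem proposition3p2:
  fixes \<xi> :: "nat \<Rightarrow> real" and N :: nat and g :: "complex \<Rightarrow> complex"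
    and la kap :: "int list"
  assumes pos: "\<And>i. i \<ge> 1 \<Longrightarrow> \<xi> i > 0"
    and nondecreasing: "\<And>i j. 1 \<le> i \<Longrightarrow> i \<le> j \<Longrightarrow> \<xi> i \<le> \<xi> j"
    and N: "N \<ge> 1"
    and g: "g \<in> admissible_fun N \<xi>"
    and la: "la \<in> signatures N"
    and kap: "kap \<in> signatures (N - 1)"
  shows "(\<lambda>mu. transition \<xi> N g la mu * link \<xi> N mu kap) summable_on signatures N
    \<and> (\<lambda>th. link \<xi> N la th * transition \<xi> (N - 1) g th kap) summable_on signatures (N - 1)
    \<and> (\<Sum>\<^sub>\<infinity>mu\<in>signatures N. transition \<xi> N g la mu * link \<xi> N mu kap)
      = (\<Sum>\<^sub>\<infinity>th\<in>signatures (N - 1). link \<xi> N la th * transition \<xi> (N - 1) g th kap)"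
proof -
  obtain n where n: "N = Suc n"
    using N by (cases N) auto
  have N_minus: "N - Suc 0 = n"
    using n by simp
  have n_le: "n \<le> N"
    using n by simp
  have la': "la \<in> signatures (Suc n)" and kap': "kap \<in> signatures n"
    using la kap n by simp_all
  have \<xi>1: "0 < \<xi> 1" and \<xi>1_le: "\<And>i. 1 \<le> i \<Longrightarrow> \<xi> 1 \<le> \<xi> i"
    using pos nondecreasing by auto
  define y where "y = \<xi> N"
  have y: "y > 0"
    using pos[of N] N by (simp add: y_def)
  obtain c where c: "laurent_expansion_on (\<xi> 1) (\<xi> N) c g"
    using admissible_fun_laurent_expansion[OF g \<xi>1 \<xi>1_le[OF N]] .
  \<comment> \<open>The annulus of \<open>m\<close> lies inside that of \<open>N\<close>, so both
    transition matrices are built from the same coefficients.\<close>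
  have coeff: "laurent_coeff \<xi> m g = c" if "1 \<le> m" "m \<le> N" for m
  proof (rule laurent_coeff_eq[OF \<xi>1 \<xi>1_le[OF \<open>1 \<le> m\<close>]])
    show "laurent_expansion_on (\<xi> 1) (\<xi> m) c g"
      using c nondecreasing[OF that] by (auto simp: laurent_expansion_on_def)
  qed
  obtain v where v: "v > 0" "g (of_real y) = of_real v"
    using admissible_fun_pos[OF g \<xi>1, of y] \<xi>1_le[OF N] by (auto simp: y_def)
  \<comment> \<open>The terms of the Laurent series at \<open>y\<close>, with sum
    \<open>v = g y\<close>; the powers of \<open>y\<close> in the link are absorbed here.\<close>
  define e where "e = (\<lambda>k. c k * y powi k)"
  have "((\<lambda>k. of_real (c k) * of_real y powi k) has_sum g (of_real y)) UNIV"
    by (rule laurent_expansion_onD[OF c]) (use y \<xi>1_le[OF N] in \<open>simp_all add: y_def\<close>)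
  then have "((\<lambda>k. complex_of_real (e k)) has_sum of_real v) UNIV"
    by (simp add: e_def v(2))
  then have e: "(e has_sum v) UNIV"
    by (simp only: has_sum_of_real_iff)
  define D where "D = (\<lambda>m mu la. det (mat m m (\<lambda>(i, j). c (mu ! i - int i - la ! j + int j))))"
  define E where "E = (\<lambda>m mu la. det (mat m m (\<lambda>(i, j). e (mu ! i - int i - la ! j + int j))))"
  have E_eq: "E m mu la = y powi (sum_list mu - sum_list la) * D m mu la"
    if "mu \<in> signatures m" "la \<in> signatures m" for m mu la
    unfolding E_def D_def e_def using that y by (intro det_shifted_powi) (auto simp: signatures_def)
  define P where "P = (\<lambda>m. \<Prod>i=1..m. 1 / Re (g (of_real (\<xi> i))))"
  have P: "P N = P n / v"
    using v n by (simp add: P_def y_def)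
  have schur: "schur_value \<xi> m mu > 0" if "mu \<in> signatures m" for m mu
    using schur_value_pos pos that by blast
  have transition: "transition \<xi> m g la mu = P m * D m mu la * (schur_value \<xi> m mu / schur_value \<xi> m la)"
    if "m \<le> N" "la \<in> signatures m" "mu \<in> signatures m" for m la mu
  \<comment> \<open>At \<open>m = 0\<close> only the empty list occurs; the empty product and the
    empty determinant are 1, and so is the Schur ratio, its value being nonzero.\<close>
  proof (cases "m = 0")
    case True
    then show ?thesis
      using that schur[OF that(2)] by (simp add: transition_def P_def D_def signatures_def)
  next
    case False
    then show ?thesis
      using that by (simp add: transition_def P_def D_def coeff)
  qed
  \<comment> \<open>Everything common to both sides that does not depend on the summation
    variable.\<close>
  define K where "K = P n * (schur_value \<xi> n kap / schur_value \<xi> N la) * y powi (sum_list la - sum_list kap)"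
  have lhs: "transition \<xi> N g la mu * link \<xi> N mu kap = K / v * E N mu la" if "interlaces kap mu" for mu
  proof -
    have mu: "mu \<in> signatures N"
      using interlaces_above_signature[OF kap' that] n by simp
    \<comment> \<open>The first factor belongs to \<open>K\<close>; the second converts
      \<open>D N mu la\<close> into \<open>E N mu la\<close>.\<close>
    have "y powi (sum_list mu - sum_list kap) =
        y powi (sum_list la - sum_list kap) * y powi (sum_list mu - sum_list la)"
      using y by (simp flip: power_int_add)
    then show ?thesis
      using that schur[OF mu]
      by (simp add: transition[OF order_refl la mu] link_def E_eq[OF mu la] K_def P N_minus mult_ac flip: y_def)
  qed
  have rhs: "link \<xi> N la th * transition \<xi> n g th kap = K * E n kap th" if "interlaces th la" for th
  proof -
    have th: "th \<in> signatures n"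
      by (rule interlaces_below_signature[OF la' that])
    \<comment> \<open>Split so that the second factor converts \<open>D n kap th\<close> into
      \<open>E n kap th\<close>.\<close>
    have "y powi (sum_list la - sum_list th) =
        y powi (sum_list la - sum_list kap) * y powi (sum_list kap - sum_list th)"
      using y by (simp flip: power_int_add)
    then show ?thesis
      using that schur[OF th]
      by (simp add: transition[OF n_le th kap'] link_def E_eq[OF kap' th] K_def N_minus flip: y_def)
  qed
  have link_0: "link \<xi> N mu th = 0" if "\<not> interlaces th mu" for mu th
    using that by (simp add: link_def)
  define S where "S = K * (\<Sum>th | interlaces th la. E n kap th)"
  have "((\<lambda>mu. K / v * E N mu la) has_sum K / v * (v * (\<Sum>th | interlaces th la. E n kap th)))
      {mu. interlaces kap mu}"
    unfolding E_def n by (intro has_sum_cmult_right has_sum_det_interlaces e la' kap')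
  \<comment> \<open>The extra normalising factor \<open>1 / v\<close> of level \<open>N\<close>
    cancels the \<open>v\<close> produced by the constant last row.\<close>
  also have "K / v * (v * (\<Sum>th | interlaces th la. E n kap th)) = S"
    using v by (simp add: S_def)
  finally have L: "((\<lambda>mu. transition \<xi> N g la mu * link \<xi> N mu kap) has_sum S) (signatures N)"
    by (rule has_sum_cong_neutral[THEN iffD1, rotated -1])
       (use interlaces_above_signature[OF kap'] in \<open>auto simp: lhs link_0 n[symmetric]\<close>)
  have "((\<lambda>th. K * E n kap th) has_sum S) {th. interlaces th la}"
    by (rule has_sum_finiteI[OF finite_interlaces_below]) (simp add: S_def sum_distrib_left)
  then have R: "((\<lambda>th. link \<xi> N la th * transition \<xi> n g th kap) has_sum S) (signatures n)"
    by (rule has_sum_cong_neutral[THEN iffD1, rotated -1])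
       (use interlaces_below_signature[OF la'] in \<open>auto simp: rhs link_0\<close>)
  show ?thesis
    unfolding n diff_Suc_1 using L[unfolded n] R[unfolded n] by (simp add: has_sum_iff)
qed

end
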